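(* For every admissible sequence $\kappa$, the $C^*$-algebras $Q(\kappa)$ and $C_b^{vv}([0,\infty),\kappa)/C_0([0,\infty),\kappa)$ are isomorphic.
   Context: Matrix algebras: for $k\in\mathbb{N}$, $M_k$ is the $C^*$-algebra of $k\times k$ complex matrices; $M_\infty$ denotes the $C^*$-algebra of compact operators on a separable infinite-dimensional Hilbert space with a fixed orthonormal basis. For $k\le l\le\infty$, $M_k\subset M_l$ is the natural inclusion (operators supported on the first $k$ coordinates). An admissible sequence is a non-decreasing function $\kappa:\mathbb{N}\to\mathbb{N}\cup\{\infty\}$ ($\mathbb{N}=\{1,2,\ldots\}$) which either stabilizes or approaches infinity. $B(\kappa)$ is the $C^*$-algebra of all bounded sequences $(m_1,m_2,\ldots)$ with $m_i\in M_{\kappa(i)}$ and $\lim_{i\to\infty}\|m_{i+1}-m_i\|=0$; $I(\kappa)\subset B(\kappa)$ is the ideal of sequences converging to zero in norm; $Q(\kappa)=B(\kappa)/I(\kappa)$. $C_b([0,\infty),M_\infty)$ is the $C^*$-algebra of bounded norm-continuous $M_\infty$-valued functions on $[0,\infty)$. The telescope $C^*$-algebra is $T(\kappa)=\{f\in C_b([0,\infty),M_\infty): f(t)\in M_{\kappa(i)}\text{ for } t\in[i,i+1),\ i\in\mathbb{N}\}$. For $[a,b]\subset[0,\infty)$ put $\mathrm{Var}_{a,b}f=\sup_{t_1,t_2\in[a,b]}\|f(t_2)-f(t_1)\|$. Put $C_0([0,\infty),\kappa)=\{f\in T(\kappa):\lim_{t\to\infty}\|f(t)\|=0\}$ and $C_b^{vv}([0,\infty),\kappa)=\{f\in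 T(\kappa):\lim_{t\to\infty}\mathrm{Var}_{t,t+1}f=0\}$. *)

theory Defs
  imports "HOL-Analysis.Analysis"
begin

section \<open>The Hilbert space of square-summable sequences\<close>

typedef ell2 = "{x :: nat \<Rightarrow> complex. summable (\<lambda>n. (cmod (x n))\<^sup>2)}"
  morphisms coord Abs_ell2
  by (rule exI[of _ "\<lambda>_. 0"]) simp

setup_lifting type_definition_ell2

lemma summable_coord: "summable (\<lambda>n. (cmod (coord x n))\<^sup>2)"
  using coord[of x] by simp

lemma ell2_summable_add:
  assumes "summable (\<lambda>n. (cmod (x n))\<^sup>2)" "summable (\<lambda>n. (cmod (y n))\<^sup>2)"
  shows "summable (\<lambda>n. (cmod (x n + y n))\<^sup>2)"
proof (rule summable_comparison_test)
  show "summable (\<lambda>n. 2 * (cmod (x n))\<^sup>2 + 2 * (cmod (y n))\<^sup>2)"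
    by (intro summable_add summable_mult assms)
  have "(cmod (a + b))\<^sup>2 \<le> 2 * (cmod a)\<^sup>2 + 2 * (cmod b)\<^sup>2" for a b :: complex
  proof -
    have "(cmod (a + b))\<^sup>2 \<le> (cmod a + cmod b)\<^sup>2"
      by (intro power_mono norm_triangle_ineq) simp
    also have "\<dots> \<le> 2 * (cmod a)\<^sup>2 + 2 * (cmod b)\<^sup>2"
      using zero_le_power2[of "cmod a - cmod b"] unfolding power2_sum power2_diff by linarith
    finally show ?thesis .
  qed
  then show "\<exists>N. \<forall>n\<ge>N. norm ((cmod (x n + y n))\<^sup>2) \<le> 2 * (cmod (x n))\<^sup>2 + 2 * (cmod (y n))\<^sup>2"
    by simp
qed

lemma ell2_summable_scale:
  assumes "summable (\<lambda>n. (cmod (x n))\<^sup>2)"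
  shows "summable (\<lambda>n. (cmod (c * x n))\<^sup>2)"
  using summable_mult[OF assms, of "(cmod c)\<^sup>2"] by (simp add: norm_mult power_mult_distrib)

lemma ell2_summable_mult:
  assumes "summable (\<lambda>n. (cmod (x n))\<^sup>2)" "summable (\<lambda>n. (cmod (y n))\<^sup>2)"
  shows "summable (\<lambda>n. cnj (x n) * y n)"
proof (rule summable_comparison_test)
  show "summable (\<lambda>n. (cmod (x n))\<^sup>2 + (cmod (y n))\<^sup>2)"
    by (intro summable_add assms)
  have "cmod (cnj a * b) \<le> (cmod a)\<^sup>2 + (cmod b)\<^sup>2" for a b
  proof -
    have "cmod a * cmod b \<ge> 0" by simp
    then show ?thesis
      using zero_le_power2[of "cmod a - cmod b"] unfolding power2_diff norm_mult complex_mod_cnj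
      by linarith
  qed
  then show "\<exists>N. \<forall>n\<ge>N. norm (cnj (x n) * y n) \<le> (cmod (x n))\<^sup>2 + (cmod (y n))\<^sup>2"
    by simp
qed

definition cinner :: "ell2 \<Rightarrow> ell2 \<Rightarrow> complex" where
  "cinner x y = (\<Sum>n. cnj (coord x n) * coord y n)"

lift_definition scaleC :: "complex \<Rightarrow> ell2 \<Rightarrow> ell2"  (infixr "*\<^sub>C" 75)
  is "\<lambda>c x n. c * x n"
  by (rule ell2_summable_scale)

instantiation ell2 :: real_inner
begin

lift_definition zero_ell2 :: ell2 is "\<lambda>_. 0" by simp

lift_definition plus_ell2 :: "ell2 \<Rightarrow> ell2 \<Rightarrow> ell2" is "\<lambda>x y n. x n + y n"
  by (rule ell2_summable_add)

lift_definition uminus_ell2 :: "ell2 \<Rightarrow> ell2" is "\<lambda>x n. - x n" by simp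

definition minus_ell2 :: "ell2 \<Rightarrow> ell2 \<Rightarrow> ell2" where
  "minus_ell2 x y = x + - y"

definition scaleR_ell2 :: "real \<Rightarrow> ell2 \<Rightarrow> ell2" where
  "scaleR_ell2 r x = complex_of_real r *\<^sub>C x"

definition inner_ell2 :: "ell2 \<Rightarrow> ell2 \<Rightarrow> real" where
  "inner_ell2 x y = Re (cinner x y)"

definition norm_ell2 :: "ell2 \<Rightarrow> real" where
  "norm_ell2 x = sqrt (inner x x)"

definition dist_ell2 :: "ell2 \<Rightarrow> ell2 \<Rightarrow> real" where
  "dist_ell2 x y = norm (x - y)"

definition sgn_ell2 :: "ell2 \<Rightarrow> ell2" where
  "sgn_ell2 x = inverse (norm x) *\<^sub>R x"

definition uniformity_ell2 :: "(ell2 \<times> ell2) filter" where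
  "uniformity_ell2 = (INF e\<in>{0 <..}. principal {(x, y). dist x y < e})"

definition open_ell2 :: "ell2 set \<Rightarrow> bool" where
  "open_ell2 U = (\<forall>x\<in>U. eventually (\<lambda>(x', y). x' = x \<longrightarrow> y \<in> U) uniformity)"

lemma inner_ell2_sums:
  "(\<lambda>n. Re (cnj (coord x n) * coord y n)) sums inner x (y :: ell2)"
  unfolding inner_ell2_def cinner_def
  by (intro sums_Re summable_sums ell2_summable_mult summable_coord)

instance
proof
  fix x y z :: ell2 and a b :: real
  show "x + y + z = x + (y + z)" by transfer (simp add: algebra_simps)
  show "x + y = y + x" by transfer (simp add: algebra_simps)
  show "0 + x = x" by transfer simp
  show "- x + x = 0" by transfer simp
  show "x - y = x + - y" by (rule minus_ell2_def)
  show "a *\<^sub>R (x + y) = a *\<^sub>R x + a *\<^sub>R y"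
    unfolding scaleR_ell2_def by transfer (simp add: algebra_simps)
  show "(a + b) *\<^sub>R x = a *\<^sub>R x + b *\<^sub>R x"
    unfolding scaleR_ell2_def by transfer (simp add: algebra_simps)
  show "a *\<^sub>R b *\<^sub>R x = (a * b) *\<^sub>R x"
    unfolding scaleR_ell2_def by transfer (simp add: algebra_simps)
  show "1 *\<^sub>R x = x" unfolding scaleR_ell2_def by transfer simp
  show "dist x y = norm (x - y)" by (rule dist_ell2_def)
  show "sgn x = inverse (norm x) *\<^sub>R x" by (rule sgn_ell2_def)
  show "uniformity = (INF e\<in>{0 <..}. principal {(x, y :: ell2). dist x y < e})"
    by (rule uniformity_ell2_def)
  show "open U = (\<forall>x\<in>U. eventually (\<lambda>(x', y). x' = x \<longrightarrow> y \<in> U) uniformity)"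
    for U :: "ell2 set" by (rule open_ell2_def)
  have comm: "(\<lambda>n. Re (cnj (coord x n) * coord y n)) = (\<lambda>n. Re (cnj (coord y n) * coord x n))"
    by (rule ext) simp
  show "inner x y = inner y x"
    using inner_ell2_sums[of x y] inner_ell2_sums[of y x] unfolding comm by (rule sums_unique2)
  show "inner (x + y) z = inner x z + inner y z"
    using inner_ell2_sums[of "x + y" z] sums_add[OF inner_ell2_sums[of x z] inner_ell2_sums[of y z]]
    by (intro sums_unique2) (simp_all add: plus_ell2.rep_eq algebra_simps)
  show "inner (a *\<^sub>R x) y = a * inner x y"
    using inner_ell2_sums[of "a *\<^sub>R x" y] sums_mult[OF inner_ell2_sums[of x y], of a]
    by (intro sums_unique2) (simp_all add: scaleR_ell2_def scaleC.rep_eq algebra_simps)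
  have self: "Re (cnj (coord x n) * coord x n) = (cmod (coord x n))\<^sup>2" for n
    unfolding cmod_power2 by (simp add: power2_eq_square)
  have sq: "(\<lambda>n. (cmod (coord x n))\<^sup>2) sums inner x x"
    using inner_ell2_sums[of x x] unfolding self .
  show "0 \<le> inner x x"
    using sums_le[OF _ sums_zero sq] by simp
  show "inner x x = 0 \<longleftrightarrow> x = 0"
  proof
    assume "inner x x = 0"
    then have "(\<Sum>n. (cmod (coord x n))\<^sup>2) = 0" using sq by (simp add: sums_iff)
    then have "\<forall>n. (cmod (coord x n))\<^sup>2 = 0"
      using suminf_eq_zero_iff[OF summable_coord[of x]] by simp
    then show "x = 0" by transfer auto
  next
    assume "x = 0"
    then have "(\<lambda>n. (cmod (coord x n))\<^sup>2) = (\<lambda>_. 0)" by (auto simp: zero_ell2.rep_eq)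
    then show "inner x x = 0" using sq by (metis sums_unique2 sums_zero)
  qed
  show "norm x = sqrt (inner x x)" by (rule norm_ell2_def)
qed

end

lemma norm_ell2_sums: "(\<lambda>n. (cmod (coord x n))\<^sup>2) sums (norm x)\<^sup>2"
proof -
  have self: "Re (cnj (coord x n) * coord x n) = (cmod (coord x n))\<^sup>2" for n
    unfolding cmod_power2 by (simp add: power2_eq_square)
  show ?thesis
    using inner_ell2_sums[of x x] unfolding self power2_norm_eq_inner .
qed

lemma norm_scaleC: "norm (c *\<^sub>C x) = cmod c * norm x"
proof -
  have "(\<lambda>n. (cmod (coord (c *\<^sub>C x) n))\<^sup>2) sums ((cmod c)\<^sup>2 * (norm x)\<^sup>2)"
    using sums_mult[OF norm_ell2_sums[of x], of "(cmod c)\<^sup>2"]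
    by (simp add: scaleC.rep_eq norm_mult power_mult_distrib)
  then have "(norm (c *\<^sub>C x))\<^sup>2 = (cmod c * norm x)\<^sup>2"
    unfolding power_mult_distrib by (rule sums_unique2[OF norm_ell2_sums])
  then show ?thesis by simp
qed

lemma bounded_linear_scaleC: "bounded_linear (\<lambda>x. c *\<^sub>C x)"
proof (rule bounded_linear_intro)
  show "c *\<^sub>C (x + y) = c *\<^sub>C x + c *\<^sub>C y" for x y
    by transfer (simp add: algebra_simps)
  show "c *\<^sub>C r *\<^sub>R x = r *\<^sub>R c *\<^sub>C x" for r x
    unfolding scaleR_ell2_def by transfer (simp add: algebra_simps)
  show "norm (c *\<^sub>C x) \<le> norm x * cmod c" for x
    by (simp add: norm_scaleC)
qed

lemma coord_minus: "coord (x - y) n = coord x n - coord y n"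
  unfolding minus_ell2_def plus_ell2.rep_eq uminus_ell2.rep_eq by simp

lemma sum_coord_le: "(\<Sum>n<N. (cmod (coord x n))\<^sup>2) \<le> (norm x)\<^sup>2"
  using sum_le_suminf[OF summable_coord, of "{..<N}" x] norm_ell2_sums[of x]
  by (simp add: sums_iff)

instance ell2 :: complete_space
proof
  fix X :: "nat \<Rightarrow> ell2"
  assume X: "Cauchy X"
  have coord_le: "cmod (coord x n) \<le> norm x" for x n
  proof -
    have "(cmod (coord x n))\<^sup>2 \<le> (\<Sum>k<Suc n. (cmod (coord x k))\<^sup>2)"
      using member_le_sum[of n "{..<Suc n}" "\<lambda>k. (cmod (coord x k))\<^sup>2"] by simp
    also have "\<dots> \<le> (norm x)\<^sup>2" by (rule sum_coord_le)
    finally show ?thesis by (rule power2_le_imp_le) simp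
  qed
  have "Cauchy (\<lambda>i. coord (X i) n)" for n
  proof (rule metric_CauchyI)
    fix e :: real assume "0 < e"
    then obtain M where M: "\<forall>i\<ge>M. \<forall>j\<ge>M. dist (X i) (X j) < e"
      using metric_CauchyD[OF X] by blast
    have "dist (coord (X i) n) (coord (X j) n) \<le> dist (X i) (X j)" for i j
      using coord_le[of "X i - X j" n] by (simp add: dist_norm coord_minus)
    then show "\<exists>M. \<forall>i\<ge>M. \<forall>j\<ge>M. dist (coord (X i) n) (coord (X j) n) < e"
      using M order_le_less_trans by blast
  qed
  then have "\<forall>n. \<exists>l. (\<lambda>i. coord (X i) n) \<longlonglongrightarrow> l"
    using Cauchy_convergent_iff convergent_def by blast
  then obtain l where l: "\<And>n. (\<lambda>i. coord (X i) n) \<longlonglongrightarrow> l n" by metis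
  have bound: "(\<Sum>n<N. (cmod (coord (X i) n - l n))\<^sup>2) \<le> e\<^sup>2"
    if M: "\<forall>j\<ge>M. dist (X i) (X j) < e" for i M N e
  proof (rule tendsto_upperbound)
    show "(\<lambda>j. \<Sum>n<N. (cmod (coord (X i) n - coord (X j) n))\<^sup>2)
        \<longlonglongrightarrow> (\<Sum>n<N. (cmod (coord (X i) n - l n))\<^sup>2)"
      by (intro tendsto_intros l)
    have "(\<Sum>n<N. (cmod (coord (X i) n - coord (X j) n))\<^sup>2) \<le> e\<^sup>2" if "M \<le> j" for j
    proof -
      have "(norm (X i - X j))\<^sup>2 \<le> e\<^sup>2"
        using M that by (intro power_mono) (auto simp: dist_norm less_imp_le)
      then show ?thesis
        using sum_coord_le[where x = "X i - X j" and N = N] by (simp add: coord_minus)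
    qed
    then show "\<forall>\<^sub>F j in sequentially. (\<Sum>n<N. (cmod (coord (X i) n - coord (X j) n))\<^sup>2) \<le> e\<^sup>2"
      unfolding eventually_sequentially by blast
  qed simp
  have diff: "summable (\<lambda>n. (cmod (coord (X i) n - l n))\<^sup>2)"
    if "\<forall>j\<ge>M. dist (X i) (X j) < e" for i M e
    by (rule summableI_nonneg_bounded[OF _ bound[OF that]]) simp
  obtain M1 where M1: "\<forall>i\<ge>M1. \<forall>j\<ge>M1. dist (X i) (X j) < 1"
    using metric_CauchyD[OF X zero_less_one] by blast
  have "summable (\<lambda>n. (cmod (coord (X M1) n + - 1 * (coord (X M1) n - l n)))\<^sup>2)"
    using M1 by (intro ell2_summable_add summable_coord ell2_summable_scale diff[of M1 M1 1]) simp
  then have sl: "summable (\<lambda>n. (cmod (l n))\<^sup>2)" by simp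
  define L where "L = Abs_ell2 l"
  have L: "coord L = l" unfolding L_def using sl by (simp add: Abs_ell2_inverse)
  have "X \<longlonglongrightarrow> L"
  proof (rule metric_LIMSEQ_I)
    fix r :: real assume r: "0 < r"
    then obtain M where M: "\<forall>i\<ge>M. \<forall>j\<ge>M. dist (X i) (X j) < r / 2"
      using metric_CauchyD[OF X, of "r / 2"] by auto
    have "dist (X i) L < r" if "M \<le> i" for i
    proof -
      have Mi: "\<forall>j\<ge>M. dist (X i) (X j) < r / 2" using M that by blast
      have "(norm (X i - L))\<^sup>2 = (\<Sum>n. (cmod (coord (X i) n - l n))\<^sup>2)"
        using norm_ell2_sums[of "X i - L"] by (simp add: sums_iff coord_minus L)
      also have "\<dots> \<le> (r / 2)\<^sup>2"
        by (rule suminf_le_const[OF diff[OF Mi] bound[OF Mi]])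
      finally have "norm (X i - L) \<le> r / 2" by (rule power2_le_imp_le) (use r in simp)
      then show ?thesis using r by (simp add: dist_norm)
    qed
    then show "\<exists>M. \<forall>i\<ge>M. dist (X i) L < r" by blast
  qed
  then show "convergent X" by (rule convergentI)
qed


section \<open>Operators\<close>

text \<open>
  Operators have type \<open>ell2 \<Rightarrow>\<^sub>L ell2\<close>, the bounded \<^emph>\<open>real\<close>-linear maps with the operator norm;
  complex linearity is imposed separately.
\<close>

definition complex_linear :: "(ell2 \<Rightarrow>\<^sub>L ell2) \<Rightarrow> bool" where
  "complex_linear A \<longleftrightarrow> (\<forall>c x. blinfun_apply A (c *\<^sub>C x) = c *\<^sub>C blinfun_apply A x)"

definition compact_operator :: "(ell2 \<Rightarrow>\<^sub>L ell2) \<Rightarrow> bool" where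
  "compact_operator A \<longleftrightarrow> compact (closure (blinfun_apply A ` cball 0 1))"

definition op_scaleC :: "complex \<Rightarrow> (ell2 \<Rightarrow>\<^sub>L ell2) \<Rightarrow> (ell2 \<Rightarrow>\<^sub>L ell2)" where
  "op_scaleC c A = Blinfun (\<lambda>x. c *\<^sub>C blinfun_apply A x)"

lemma op_scaleC_apply: "blinfun_apply (op_scaleC c A) x = c *\<^sub>C blinfun_apply A x"
  unfolding op_scaleC_def
  by (subst bounded_linear_Blinfun_apply)
    (rule bounded_linear_compose[OF bounded_linear_scaleC blinfun.bounded_linear_right] refl)+

definition op_adjoint :: "(ell2 \<Rightarrow>\<^sub>L ell2) \<Rightarrow> (ell2 \<Rightarrow>\<^sub>L ell2)" where
  "op_adjoint A =
    (THE B. \<forall>x y. cinner (blinfun_apply B x) y = cinner x (blinfun_apply A y))"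

lift_definition truncate :: "enat \<Rightarrow> ell2 \<Rightarrow> ell2"
  is "\<lambda>k x n. if enat n < k then x n else 0"
proof -
  fix k :: enat and x :: "nat \<Rightarrow> complex"
  assume x: "summable (\<lambda>n. (cmod (x n))\<^sup>2)"
  show "summable (\<lambda>n. (cmod (if enat n < k then x n else 0))\<^sup>2)"
    by (rule summable_comparison_test[OF _ x]) auto
qed

text \<open>
  For finite \<open>k\<close> the algebra of \<open>k \<times> k\<close> matrices is identified with the operators supported on
  the first \<open>k\<close> coordinates (those with index \<open>0, \<dots>, k - 1\<close>), so that all the inclusions between
  matrix algebras become set inclusions; for \<open>k = \<infinity>\<close> the support condition is void.
\<close>

definition M :: "enat \<Rightarrow> (ell2 \<Rightarrow>\<^sub>L ell2) set" where
  "M k = {A. complex_linear A \<and> compact_operator A \<and>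
    (\<forall>x. blinfun_apply A x = truncate k (blinfun_apply A (truncate k x)))}"


section \<open>Algebras, quotients and isomorphisms\<close>

text \<open>The operations of a (not necessarily unital) \<open>C\<^sup>*\<close>-algebra on a carrier set.\<close>

record 'a star_algebra =
  carrier :: "'a set"
  add :: "'a \<Rightarrow> 'a \<Rightarrow> 'a"
  scale :: "complex \<Rightarrow> 'a \<Rightarrow> 'a"
  mult :: "'a \<Rightarrow> 'a \<Rightarrow> 'a"
  star :: "'a \<Rightarrow> 'a"
  nrm :: "'a \<Rightarrow> real"

definition coset :: "'a star_algebra \<Rightarrow> 'a set \<Rightarrow> 'a \<Rightarrow> 'a set" where
  "coset A I x = add A x ` I"

text \<open>
  The quotient by an ideal. Each operation is the union of the cosets obtained from all choices of
  representatives, which is a single coset when \<open>I\<close> is a self-adjoint ideal.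
\<close>

definition quotient_algebra :: "'a star_algebra \<Rightarrow> 'a set \<Rightarrow> 'a set star_algebra" where
  "quotient_algebra A I = \<lparr>
    carrier = coset A I ` carrier A,
    add = (\<lambda>X Y. \<Union>x\<in>X. \<Union>y\<in>Y. coset A I (add A x y)),
    scale = (\<lambda>c X. \<Union>x\<in>X. coset A I (scale A c x)),
    mult = (\<lambda>X Y. \<Union>x\<in>X. \<Union>y\<in>Y. coset A I (mult A x y)),
    star = (\<lambda>X. \<Union>x\<in>X. coset A I (star A x)),
    nrm = (\<lambda>X. INF x\<in>X. nrm A x)\<rparr>"

text \<open>
  A \<open>*\<close>-isomorphism of \<open>C\<^sup>*\<close>-algebras is automatically isometric. Since the record does not carry
  the \<open>C\<^sup>*\<close>-axioms, preservation of the norm is listed explicitly.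
\<close>

definition star_isomorphism ::
    "('a \<Rightarrow> 'b) \<Rightarrow> 'a star_algebra \<Rightarrow> 'b star_algebra \<Rightarrow> bool" where
  "star_isomorphism \<phi> A B \<longleftrightarrow>
    bij_betw \<phi> (carrier A) (carrier B) \<and>
    (\<forall>x\<in>carrier A. \<forall>y\<in>carrier A. \<phi> (add A x y) = add B (\<phi> x) (\<phi> y)) \<and>
    (\<forall>c. \<forall>x\<in>carrier A. \<phi> (scale A c x) = scale B c (\<phi> x)) \<and>
    (\<forall>x\<in>carrier A. \<forall>y\<in>carrier A. \<phi> (mult A x y) = mult B (\<phi> x) (\<phi> y)) \<and>
    (\<forall>x\<in>carrier A. \<phi> (star A x) = star B (\<phi> x)) \<and>
    (\<forall>x\<in>carrier A. nrm B (\<phi> x) = nrm A x)"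

definition star_isomorphic :: "'a star_algebra \<Rightarrow> 'b star_algebra \<Rightarrow> bool"
    (infix "\<cong>\<^sup>*" 50) where
  "A \<cong>\<^sup>* B \<longleftrightarrow> (\<exists>\<phi>. star_isomorphism \<phi> A B)"

text \<open>Operator-valued functions with pointwise operations and the supremum norm.\<close>

definition pointwise_algebra ::
    "('i \<Rightarrow> ell2 \<Rightarrow>\<^sub>L ell2) set \<Rightarrow> ('i \<Rightarrow> ell2 \<Rightarrow>\<^sub>L ell2) star_algebra" where
  "pointwise_algebra S = \<lparr>
    carrier = S,
    add = (\<lambda>f g t. f t + g t),
    scale = (\<lambda>c f t. op_scaleC c (f t)),
    mult = (\<lambda>f g t. f t o\<^sub>L g t),
    star = (\<lambda>f t. op_adjoint (f t)),
    nrm = (\<lambda>f. SUP t. norm (f t))\<rparr>"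


section \<open>The algebras attached to an admissible sequence\<close>

text \<open>
  Sequences are indexed by \<open>{1, 2, \<dots>}\<close>. The value \<open>\<kappa> 0\<close> is irrelevant, sequences of operators are
  extended by \<open>0\<close> to the index \<open>0\<close>, and functions on \<open>[0, \<infinity>)\<close> are extended by \<open>0\<close> to the
  negative reals.
\<close>

definition admissible :: "(nat \<Rightarrow> enat) \<Rightarrow> bool" where
  "admissible \<kappa> \<longleftrightarrow>
    (\<forall>i\<ge>1. 1 \<le> \<kappa> i) \<and> mono_on {1..} \<kappa> \<and>
    ((\<exists>N\<ge>1. \<forall>i\<ge>N. \<kappa> i = \<kappa> N) \<or> \<kappa> \<longlonglongrightarrow> \<infinity>)"

definition B_set :: "(nat \<Rightarrow> enat) \<Rightarrow> (nat \<Rightarrow> ell2 \<Rightarrow>\<^sub>L ell2) set" where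
  "B_set \<kappa> = {m. m 0 = 0 \<and> (\<forall>i\<ge>1. m i \<in> M (\<kappa> i)) \<and> bounded (range m) \<and>
    (\<lambda>i. norm (m (Suc i) - m i)) \<longlonglongrightarrow> 0}"

definition I_set :: "(nat \<Rightarrow> enat) \<Rightarrow> (nat \<Rightarrow> ell2 \<Rightarrow>\<^sub>L ell2) set" where
  "I_set \<kappa> = {m \<in> B_set \<kappa>. (\<lambda>i. norm (m i)) \<longlonglongrightarrow> 0}"

definition Q :: "(nat \<Rightarrow> enat) \<Rightarrow> (nat \<Rightarrow> ell2 \<Rightarrow>\<^sub>L ell2) set star_algebra" where
  "Q \<kappa> = quotient_algebra (pointwise_algebra (B_set \<kappa>)) (I_set \<kappa>)"

definition Cb_set :: "(real \<Rightarrow> ell2 \<Rightarrow>\<^sub>L ell2) set" where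
  "Cb_set = {f. (\<forall>t<0. f t = 0) \<and> (\<forall>t\<ge>0. f t \<in> M \<infinity>) \<and>
    continuous_on {0..} f \<and> bounded (f ` {0..})}"

definition telescope_set :: "(nat \<Rightarrow> enat) \<Rightarrow> (real \<Rightarrow> ell2 \<Rightarrow>\<^sub>L ell2) set" where
  "telescope_set \<kappa> =
    {f \<in> Cb_set. \<forall>i\<ge>1. \<forall>t\<in>{real i..<real (i + 1)}. f t \<in> M (\<kappa> i)}"

definition Var :: "real \<Rightarrow> real \<Rightarrow> (real \<Rightarrow> ell2 \<Rightarrow>\<^sub>L ell2) \<Rightarrow> real" where
  "Var a b f = (SUP (t1, t2)\<in>{a..b} \<times> {a..b}. norm (f t2 - f t1))"

definition C0_set :: "(nat \<Rightarrow> enat) \<Rightarrow> (real \<Rightarrow> ell2 \<Rightarrow>\<^sub>L ell2) set" where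
  "C0_set \<kappa> = {f \<in> telescope_set \<kappa>. ((\<lambda>t. norm (f t)) \<longlongrightarrow> 0) at_top}"

definition Cvv_set :: "(nat \<Rightarrow> enat) \<Rightarrow> (real \<Rightarrow> ell2 \<Rightarrow>\<^sub>L ell2) set" where
  "Cvv_set \<kappa> = {f \<in> telescope_set \<kappa>. ((\<lambda>t. Var t (t + 1) f) \<longlongrightarrow> 0) at_top}"

end

theory Submission
  imports Defs
begin

text \<open>
  Restricting a function \<open>f\<close> on the half-line to the positive integers is a \<open>*\<close>-homomorphism from
  \<open>Cvv_set \<kappa>\<close> to \<open>B_set \<kappa>\<close>: the condition on the variation of \<open>f\<close> forces the differences of
  consecutive values to tend to zero. The same condition shows that the restriction is a null sequence exactly when
  \<open>f\<close> vanishes at infinity (\<open>sample_tendsto_zero_iff\<close>), so that \<open>C0_set \<kappa>\<close> is the preimage of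
  \<open>I_set \<kappa>\<close>. Conversely, a sequence \<open>m\<close> extends to the half-line by linear interpolation. To stay in
  the telescope, the interpolation on \<open>[i, i + 1)\<close> runs from \<open>m (i - 1)\<close> to \<open>m i\<close>; restricting it
  therefore gives \<open>m\<close> shifted by one index, which agrees with \<open>m\<close> modulo null sequences because the
  consecutive differences of \<open>m\<close> tend to zero (\<open>interpolate_section\<close>).

  Hence restriction induces a bijective \<open>*\<close>-homomorphism of the quotients. It is
  isometric because neither restriction nor interpolation increases the supremum norm, so every class
  on one side contains, for each element of the corresponding class, an element that is no larger.
  The lemma \<open>quotient_star_isomorphic_of_reindexing\<close> isolates this argument.

  The operations on the quotients are well defined because the sets involved are \<open>*\<close>-algebras and
  ideals (\<open>pointwise_ideal_slow\<close>). This rests on each \<open>M k\<close> being closed under sums, products and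
  adjoints. The existence of adjoints is a coordinate version of the Riesz representation theorem
  (\<open>adjoint_value_exists\<close>), and their compactness is Schauder's theorem for a Hilbert space
  (\<open>compact_operator_op_adjoint\<close>).
\<close>

section \<open>Adjoints of operators on the sequence space\<close>

lemma ell2_eqI: "(\<And>n. coord x n = coord y n) \<Longrightarrow> x = y"
  using coord_inject[of x y] by blast

lemma cinner_sums: "(\<lambda>n. cnj (coord x n) * coord y n) sums cinner x y"
  unfolding cinner_def by (intro summable_sums ell2_summable_mult summable_coord)

lemma cinner_commute: "cinner y x = cnj (cinner x y)"
proof (rule sums_unique2[OF cinner_sums])
  show "(\<lambda>n. cnj (coord y n) * coord x n) sums cnj (cinner x y)"
    using sums_cnj[THEN iffD2, OF cinner_sums[of x y]] by (simp add: mult.commute)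
qed

lemma cinner_add_right: "cinner x (y + z) = cinner x y + cinner x z"
  using sums_add[OF cinner_sums[of x y] cinner_sums[of x z]]
  by (intro sums_unique2[OF cinner_sums]) (simp add: plus_ell2.rep_eq algebra_simps)

lemma cinner_scaleC_right: "cinner x (c *\<^sub>C y) = c * cinner x y"
  using sums_mult[OF cinner_sums[of x y], of c]
  by (intro sums_unique2[OF cinner_sums]) (simp add: scaleC.rep_eq algebra_simps)

lemma cinner_add_left: "cinner (x + y) z = cinner x z + cinner y z"
  using cinner_add_right[of z x y] by (metis cinner_commute complex_cnj_add)

lemma cinner_scaleC_left: "cinner (c *\<^sub>C x) y = cnj c * cinner x y"
  using cinner_scaleC_right[of y c x] by (metis cinner_commute complex_cnj_mult)

lemma cinner_diff_right: "cinner x (y - z) = cinner x y - cinner x z"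
  using cinner_add_right[of x "y - z" z] by simp

lemma cinner_diff_left: "cinner (x - y) z = cinner x z - cinner y z"
  using cinner_add_left[of "x - y" y z] by simp

lemma Re_cinner_self: "Re (cinner x x) = (norm x)\<^sup>2"
  by (simp add: power2_norm_eq_inner inner_ell2_def)

lemma cinner_eqI: "(\<And>y. cinner x y = cinner z y) \<Longrightarrow> x = z"
  using Re_cinner_self[of "x - z"] by (simp add: cinner_diff_left)

text \<open>
  The real Cauchy--Schwarz inequality applies after rotating one argument by the phase that makes
  the inner product real and nonnegative.
\<close>

lemma cinner_Cauchy_Schwarz: "cmod (cinner x y) \<le> norm x * norm y"
proof (cases "cinner x y = 0")
  case False
  define c where "c = cnj (cinner x y) / cmod (cinner x y)"
  have c: "cmod c = 1"
    using False by (simp add: c_def norm_divide)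
  have "c * cinner x y = cmod (cinner x y)"
    using False complex_norm_square[of "cinner x y"]
    by (simp add: c_def field_simps power2_eq_square)
  then have "cmod (cinner x y) = inner x (c *\<^sub>C y)"
    by (simp add: inner_ell2_def cinner_scaleC_right)
  also have "\<dots> \<le> norm x * norm (c *\<^sub>C y)"
    by (rule norm_cauchy_schwarz)
  finally show ?thesis
    by (simp add: norm_scaleC c)
qed simp

lemma bounded_linear_cinner: "bounded_linear (cinner x)"
proof (rule bounded_linear_intro)
  show "cinner x (r *\<^sub>R y) = r *\<^sub>R cinner x y" for r y
    by (simp add: scaleR_ell2_def cinner_scaleC_right scaleR_conv_of_real)
  show "cmod (cinner x y) \<le> norm y * norm x" for y
    using cinner_Cauchy_Schwarz[of x y] by (simp add: mult.commute)
qed (rule cinner_add_right)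

(* Frees the name truncate from the record operation on star_algebra. *)
hide_const (open) star_algebra.truncate

lift_definition unit_vector :: "nat \<Rightarrow> ell2" is "\<lambda>n k. if k = n then 1 else 0"
proof -
  show "summable (\<lambda>k. (cmod (if k = n then 1 else 0))\<^sup>2)" for n :: nat
    by (rule summable_finite[of "{n}"]) auto
qed

lemma coord_sum_unit_vector:
  "coord (\<Sum>n<N. c n *\<^sub>C unit_vector n) k = (if k < N then c k else 0)"
  by (induction N) (auto simp: less_Suc_eq zero_ell2.rep_eq plus_ell2.rep_eq scaleC.rep_eq unit_vector.rep_eq)

lemma truncate_eq_sum: "truncate (enat N) y = (\<Sum>n<N. coord y n *\<^sub>C unit_vector n)"
  by (rule ell2_eqI) (simp add: truncate.rep_eq coord_sum_unit_vector)

lemma norm_sum_unit_vector: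
  "(norm (\<Sum>n<N. c n *\<^sub>C unit_vector n))\<^sup>2 = (\<Sum>n<N. (cmod (c n))\<^sup>2)"
proof (rule sums_unique2[OF norm_ell2_sums])
  have "(\<lambda>n. (cmod (if n < N then c n else 0))\<^sup>2) sums (\<Sum>n<N. (cmod (if n < N then c n else 0))\<^sup>2)"
    by (rule sums_finite) auto
  then show "(\<lambda>n. (cmod (coord (\<Sum>n<N. c n *\<^sub>C unit_vector n) n))\<^sup>2) sums (\<Sum>n<N. (cmod (c n))\<^sup>2)"
    by (simp add: coord_sum_unit_vector)
qed

lemma truncate_tendsto: "(\<lambda>N. truncate (enat N) y) \<longlonglongrightarrow> y"
proof -
  have Pythagoras: "(norm (y - truncate k y))\<^sup>2 = (norm y)\<^sup>2 - (norm (truncate k y))\<^sup>2" for k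
  proof (rule sums_unique2[OF norm_ell2_sums])
    show "(\<lambda>n. (cmod (coord (y - truncate k y) n))\<^sup>2) sums ((norm y)\<^sup>2 - (norm (truncate k y))\<^sup>2)"
      using sums_diff[OF norm_ell2_sums[of y] norm_ell2_sums[of "truncate k y"]]
      by (rule back_subst[of "\<lambda>f. f sums _"]) (auto simp: coord_minus truncate.rep_eq)
  qed
  have "(\<lambda>N. (norm (truncate (enat N) y))\<^sup>2) \<longlonglongrightarrow> (norm y)\<^sup>2"
    using norm_ell2_sums[of y] by (simp add: truncate_eq_sum norm_sum_unit_vector sums_def)
  then have "(\<lambda>N. (norm (y - truncate (enat N) y))\<^sup>2) \<longlonglongrightarrow> (norm y)\<^sup>2 - (norm y)\<^sup>2"
    unfolding Pythagoras by (rule tendsto_diff[OF tendsto_const])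
  then have "(\<lambda>N. norm (y - truncate (enat N) y)) \<longlonglongrightarrow> 0"
    by (simp add: tendsto_null_power)
  then have "(\<lambda>N. norm (truncate (enat N) y - y)) \<longlonglongrightarrow> 0"
    by (simp add: norm_minus_commute)
  then show ?thesis
    using LIM_zero_cancel tendsto_norm_zero_iff by blast
qed

lemma complex_linearD: "complex_linear A \<Longrightarrow> blinfun_apply A (c *\<^sub>C x) = c *\<^sub>C blinfun_apply A x"
  by (simp add: complex_linear_def)

text \<open>
  The value of the adjoint at \<open>x\<close> is the vector with coordinates \<open>cinner (A e\<^sub>n) x\<close>. These are square
  summable because testing \<open>A\<close> on \<open>y = (\<Sum>n<N. c\<^sub>n e\<^sub>n)\<close>, where \<open>c\<^sub>n\<close> are the coordinates themselves,
  gives \<open>\<parallel>y\<parallel>\<^sup>2 = cinner (A y) x \<le> \<parallel>A\<parallel> \<parallel>y\<parallel> \<parallel>x\<parallel>\<close>.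
\<close>

lemma adjoint_value_exists:
  assumes A: "complex_linear A"
  shows "\<exists>z. \<forall>y. cinner z y = cinner x (blinfun_apply A y)"
proof -
  define c where "c n = cinner (blinfun_apply A (unit_vector n)) x" for n
  have A_sum: "blinfun_apply A (\<Sum>n<N. a n *\<^sub>C unit_vector n)
      = (\<Sum>n<N. a n *\<^sub>C blinfun_apply A (unit_vector n))" for a N
    using A by (simp add: blinfun.sum_right complex_linearD)
  have cinner_A_sum: "cinner x (blinfun_apply A (\<Sum>n<N. a n *\<^sub>C unit_vector n))
      = (\<Sum>n<N. cnj (c n) * a n)" for a N
    unfolding A_sum linear_sum[OF bounded_linear.linear[OF bounded_linear_cinner]]
    by (simp add: c_def cinner_scaleC_right cinner_commute[of x] mult.commute)
  have partial: "(\<Sum>n<N. (cmod (c n))\<^sup>2) \<le> (norm A * norm x)\<^sup>2" for N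
  proof -
    define y where "y = (\<Sum>n<N. c n *\<^sub>C unit_vector n)"
    have y: "(norm y)\<^sup>2 = (\<Sum>n<N. (cmod (c n))\<^sup>2)"
      unfolding y_def by (rule norm_sum_unit_vector)
    have "cinner x (blinfun_apply A y) = of_real ((norm y)\<^sup>2)"
      unfolding y unfolding y_def cinner_A_sum
      unfolding of_real_sum complex_norm_square by (simp add: mult.commute)
    then have "(norm y)\<^sup>2 = cmod (cinner x (blinfun_apply A y))"
      by (simp only: norm_of_real abs_of_nonneg[OF zero_le_power2])
    also have "\<dots> \<le> norm x * (norm A * norm y)"
      by (rule order_trans[OF cinner_Cauchy_Schwarz mult_left_mono[OF norm_blinfun]]) simp
    finally have "norm y * norm y \<le> (norm A * norm x) * norm y"
      by (simp add: power2_eq_square mult_ac)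
    then have "norm y \<le> norm A * norm x"
      by (cases "norm y = 0") (simp_all add: mult_le_cancel_right)
    then show ?thesis
      unfolding y[symmetric] by (intro power_mono) simp_all
  qed
  have "summable (\<lambda>n. (cmod (c n))\<^sup>2)"
    by (rule summableI_nonneg_bounded[OF _ partial]) simp
  then have z: "coord (Abs_ell2 c) = c"
    by (simp add: Abs_ell2_inverse)
  have "cinner (Abs_ell2 c) y = cinner x (blinfun_apply A y)" for y
  proof (rule sums_unique2[OF cinner_sums])
    have "(\<lambda>N. cinner x (blinfun_apply A (truncate (enat N) y))) \<longlonglongrightarrow> cinner x (blinfun_apply A y)"
      by (intro bounded_linear.tendsto[OF bounded_linear_cinner]
          bounded_linear.tendsto[OF blinfun.bounded_linear_right] truncate_tendsto)
    then show "(\<lambda>n. cnj (coord (Abs_ell2 c) n) * coord y n) sums cinner x (blinfun_apply A y)"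
      unfolding truncate_eq_sum cinner_A_sum sums_def z .
  qed
  then show ?thesis by blast
qed

lemma op_adjoint_eqI:
  assumes "\<And>x y. cinner (blinfun_apply B x) y = cinner x (blinfun_apply A y)"
  shows "op_adjoint A = B"
  unfolding op_adjoint_def
proof (rule the_equality)
  fix C
  assume "\<forall>x y. cinner (blinfun_apply C x) y = cinner x (blinfun_apply A y)"
  then show "C = B"
    using assms by (intro blinfun_eqI cinner_eqI) simp
qed (use assms in blast)

lemma op_adjoint:
  assumes A: "complex_linear A"
  shows "cinner (blinfun_apply (op_adjoint A) x) y = cinner x (blinfun_apply A y)"
    and "norm (op_adjoint A) \<le> norm A"
proof -
  obtain g where g: "\<And>x y. cinner (g x) y = cinner x (blinfun_apply A y)"
    using adjoint_value_exists[OF A] by metis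
  have bound: "norm (g x) \<le> norm x * norm A" for x
  proof -
    have "norm (g x) * norm (g x) = Re (cinner x (blinfun_apply A (g x)))"
      by (simp add: Re_cinner_self power2_eq_square flip: g)
    also have "\<dots> \<le> cmod (cinner x (blinfun_apply A (g x)))"
      by (rule complex_Re_le_cmod)
    also have "\<dots> \<le> norm x * (norm A * norm (g x))"
      by (rule order_trans[OF cinner_Cauchy_Schwarz mult_left_mono[OF norm_blinfun]]) simp
    finally have "norm (g x) * norm (g x) \<le> (norm x * norm A) * norm (g x)"
      by (simp add: mult_ac)
    then show ?thesis
      by (cases "norm (g x) = 0") (simp_all add: mult_le_cancel_right)
  qed
  have "bounded_linear g"
  proof (rule bounded_linear_intro)
    show "g (x + y) = g x + g y" for x y
      by (rule cinner_eqI) (simp add: g cinner_add_left)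
    show "g (r *\<^sub>R x) = r *\<^sub>R g x" for r x
      by (rule cinner_eqI) (simp add: g scaleR_ell2_def cinner_scaleC_left)
  qed (rule bound)
  then have apply_g: "blinfun_apply (Blinfun g) = g"
    by (rule bounded_linear_Blinfun_apply)
  have adj: "op_adjoint A = Blinfun g"
    by (rule op_adjoint_eqI) (simp add: apply_g g)
  show "cinner (blinfun_apply (op_adjoint A) x) y = cinner x (blinfun_apply A y)"
    by (simp add: adj apply_g g)
  show "norm (op_adjoint A) \<le> norm A"
    by (rule norm_blinfun_bound) (use bound in \<open>simp_all add: adj apply_g mult.commute\<close>)
qed

lemma complex_linear_op_adjoint:
  assumes "complex_linear A"
  shows "complex_linear (op_adjoint A)"
  unfolding complex_linear_def
  by (intro allI cinner_eqI) (simp add: op_adjoint[OF assms] cinner_scaleC_left)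

lemma op_adjoint_diff:
  assumes "complex_linear A" "complex_linear B"
  shows "op_adjoint (A - B) = op_adjoint A - op_adjoint B"
  by (rule op_adjoint_eqI)
    (simp add: blinfun.diff_left cinner_diff_left cinner_diff_right op_adjoint assms)

lemma scaleC_add_right: "c *\<^sub>C (x + y) = c *\<^sub>C x + c *\<^sub>C y"
  by (rule linear_add[OF bounded_linear.linear[OF bounded_linear_scaleC]])

lemma scaleC_diff_right: "c *\<^sub>C (x - y) = c *\<^sub>C x - c *\<^sub>C y"
  by (rule linear_diff[OF bounded_linear.linear[OF bounded_linear_scaleC]])

lemma scaleC_zero_right: "c *\<^sub>C 0 = 0"
  by (rule linear_0[OF bounded_linear.linear[OF bounded_linear_scaleC]])

lemma op_scaleC_add: "op_scaleC c (A + B) = op_scaleC c A + op_scaleC c B"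
  by (rule blinfun_eqI) (simp add: op_scaleC_apply blinfun.add_left scaleC_add_right)

lemma op_scaleC_diff: "op_scaleC c (A - B) = op_scaleC c A - op_scaleC c B"
  by (rule blinfun_eqI) (simp add: op_scaleC_apply blinfun.diff_left scaleC_diff_right)

lemma op_scaleC_of_real: "op_scaleC (complex_of_real r) A = r *\<^sub>R A"
  by (rule blinfun_eqI) (simp add: op_scaleC_apply blinfun.scaleR_left scaleR_ell2_def)

lemma norm_op_scaleC_le: "norm (op_scaleC c A) \<le> cmod c * norm A"
  by (rule norm_blinfun_bound)
    (simp_all add: op_scaleC_apply norm_scaleC mult_left_mono norm_blinfun mult.assoc)

lemma scaleC_scaleC: "c *\<^sub>C d *\<^sub>C x = (c * d) *\<^sub>C x"
  by (rule ell2_eqI) (simp add: scaleC.rep_eq)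

lemma complex_linear_add: "complex_linear A \<Longrightarrow> complex_linear B \<Longrightarrow> complex_linear (A + B)"
  by (simp add: complex_linear_def blinfun.add_left scaleC_add_right)

lemma complex_linear_op_scaleC: "complex_linear A \<Longrightarrow> complex_linear (op_scaleC c A)"
  by (simp add: complex_linear_def op_scaleC_apply scaleC_scaleC mult.commute)

lemma complex_linear_compose: "complex_linear A \<Longrightarrow> complex_linear B \<Longrightarrow> complex_linear (A o\<^sub>L B)"
  by (simp add: complex_linear_def)

section \<open>Compact operators and matrix algebras\<close>

text \<open>
  Compactness in terms of subsequences turns closure of the compact operators under the algebraic
  operations into extraction of successive subsequences.
\<close>

lemma compact_operator_iff_subseq:
  "compact_operator A \<longleftrightarrow>
    (\<forall>x :: nat \<Rightarrow> ell2. bounded (range x) \<longrightarrow>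
      (\<exists>r. strict_mono r \<and> convergent (\<lambda>n. blinfun_apply A (x (r n)))))"
proof (intro iffI allI impI)
  fix x :: "nat \<Rightarrow> ell2"
  assume A: "compact_operator A" and "bounded (range x)"
  then obtain b where b: "b > 0" "\<And>n. norm (x n) \<le> b"
    unfolding bounded_pos by auto
  have "\<forall>n. blinfun_apply A (x n /\<^sub>R b) \<in> closure (blinfun_apply A ` cball 0 1)"
    using b by (intro allI subsetD[OF closure_subset] imageI) (simp add: field_simps)
  then obtain l r where "l \<in> closure (blinfun_apply A ` cball 0 1)"
    and r: "strict_mono r" "((\<lambda>n. blinfun_apply A (x n /\<^sub>R b)) \<circ> r) \<longlonglongrightarrow> l"
    by (rule seq_compactE[OF compact_imp_seq_compact[OF A[unfolded compact_operator_def]]])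
  have "(\<lambda>n. b *\<^sub>R blinfun_apply A (x (r n) /\<^sub>R b)) \<longlonglongrightarrow> b *\<^sub>R l"
    using r(2) by (intro tendsto_intros) (simp add: o_def)
  then have "convergent (\<lambda>n. blinfun_apply A (x (r n)))"
    using b(1) by (simp add: blinfun.scaleR_right convergentI)
  then show "\<exists>r. strict_mono r \<and> convergent (\<lambda>n. blinfun_apply A (x (r n)))"
    using r(1) by blast
next
  assume sub: "\<forall>x :: nat \<Rightarrow> ell2. bounded (range x) \<longrightarrow>
      (\<exists>r. strict_mono r \<and> convergent (\<lambda>n. blinfun_apply A (x (r n))))"
  show "compact_operator A"
    unfolding compact_operator_def compact_eq_seq_compact_metric
  proof (rule seq_compactI)
    fix y :: "nat \<Rightarrow> ell2"
    assume y: "\<forall>n. y n \<in> closure (blinfun_apply A ` cball 0 1)"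
    have "\<exists>x\<in>cball 0 1. dist (blinfun_apply A x) (y n) < inverse (real (Suc n))" for n
    proof -
      have "inverse (real (Suc n)) > 0"
        by simp
      then have "\<exists>z\<in>blinfun_apply A ` cball 0 1. dist z (y n) < inverse (real (Suc n))"
        using y unfolding closure_approachable by blast
      then show ?thesis
        by (simp only: bex_simps)
    qed
    then obtain x where x: "\<And>n. x n \<in> cball 0 1"
      "\<And>n. dist (blinfun_apply A (x n)) (y n) < inverse (real (Suc n))"
      by metis
    have "bounded (range x)"
      using x(1) by (intro bounded_subset[OF bounded_cball[of 0 1]]) blast
    then obtain r l where r: "strict_mono r" "(\<lambda>n. blinfun_apply A (x (r n))) \<longlonglongrightarrow> l"
      using sub[rule_format, of x] unfolding convergent_def by blast
    have inv: "(\<lambda>n. inverse (real (Suc (r n)))) \<longlonglongrightarrow> 0"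
      using LIMSEQ_subseq_LIMSEQ[OF LIMSEQ_inverse_real_of_nat r(1)] by (simp add: o_def)
    have "(\<lambda>n. dist (blinfun_apply A (x (r n))) (y (r n))) \<longlonglongrightarrow> 0"
      by (rule real_tendsto_sandwich[OF _ _ tendsto_const inv])
        (use x(2) in \<open>auto intro!: always_eventually less_imp_le\<close>)
    then have lim: "(y \<circ> r) \<longlonglongrightarrow> l"
      using Lim_transform[OF r(2), of "y \<circ> r"]
      by (simp add: o_def dist_norm tendsto_norm_zero_iff norm_minus_commute)
    then have "l \<in> closure (blinfun_apply A ` cball 0 1)"
      using y by (intro closed_sequentially[OF closed_closure _ lim]) simp
    then show "\<exists>l\<in>closure (blinfun_apply A ` cball 0 1). \<exists>r. strict_mono r \<and> (y \<circ> r) \<longlonglongrightarrow> l"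
      using r(1) lim by blast
  qed
qed

lemma bounded_range_subseq: "bounded (range x) \<Longrightarrow> bounded (range (\<lambda>n. x (r n)))"
  by (erule bounded_subset) blast

lemma bounded_range_blinfun:
  assumes "bounded (range x)"
  shows "bounded (range (\<lambda>n. blinfun_apply A (x n)))"
  using bounded_linear_image[OF assms blinfun.bounded_linear_right[of A]] by (simp add: image_image)

lemma compact_operator_subseq:
  assumes "compact_operator A" "bounded (range x)"
  obtains r where "strict_mono (r :: nat \<Rightarrow> nat)" "convergent (\<lambda>n. blinfun_apply A (x (r n)))"
  using assms compact_operator_iff_subseq by blast

lemma compact_operator_add:
  assumes A: "compact_operator A" and B: "compact_operator B"
  shows "compact_operator (A + B)"
  unfolding compact_operator_iff_subseq
proof (intro allI impI)
  fix x :: "nat \<Rightarrow> ell2"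
  assume x: "bounded (range x)"
  obtain r where r: "strict_mono r" "convergent (\<lambda>n. blinfun_apply A (x (r n)))"
    using A x by (rule compact_operator_subseq)
  obtain s where s: "strict_mono s" "convergent (\<lambda>n. blinfun_apply B (x (r (s n))))"
    using B bounded_range_subseq[OF x, of r] by (rule compact_operator_subseq)
  have "convergent (\<lambda>n. blinfun_apply A (x (r (s n))))"
    using convergent_subseq_convergent[OF r(2) s(1)] by (simp add: o_def)
  then have "convergent (\<lambda>n. blinfun_apply (A + B) (x ((r \<circ> s) n)))"
    using s(2) by (simp add: blinfun.add_left convergent_add)
  then show "\<exists>q. strict_mono q \<and> convergent (\<lambda>n. blinfun_apply (A + B) (x (q n)))"
    using strict_mono_o[OF r(1) s(1)] by blast
qed

lemma compact_operator_compose_left: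
  assumes B: "compact_operator B"
  shows "compact_operator (A o\<^sub>L B)"
  unfolding compact_operator_iff_subseq
proof (intro allI impI)
  fix x :: "nat \<Rightarrow> ell2"
  assume "bounded (range x)"
  with B obtain r where r: "strict_mono r" "convergent (\<lambda>n. blinfun_apply B (x (r n)))"
    by (rule compact_operator_subseq)
  have "convergent (\<lambda>n. blinfun_apply (A o\<^sub>L B) (x (r n)))"
    using bounded_linear.convergent[OF blinfun.bounded_linear_right[of A] r(2)] by simp
  then show "\<exists>r. strict_mono r \<and> convergent (\<lambda>n. blinfun_apply (A o\<^sub>L B) (x (r n)))"
    using r(1) by blast
qed

lemma compact_operator_compose_right:
  assumes A: "compact_operator A"
  shows "compact_operator (A o\<^sub>L B)"
  unfolding compact_operator_iff_subseq
proof (intro allI impI)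
  fix x :: "nat \<Rightarrow> ell2"
  assume "bounded (range x)"
  then obtain r where "strict_mono r" "convergent (\<lambda>n. blinfun_apply A (blinfun_apply B (x (r n))))"
    by (rule compact_operator_subseq[OF A bounded_range_blinfun])
  then show "\<exists>r. strict_mono r \<and> convergent (\<lambda>n. blinfun_apply (A o\<^sub>L B) (x (r n)))"
    by auto
qed

lemma compact_operator_op_scaleC:
  assumes A: "compact_operator A"
  shows "compact_operator (op_scaleC c A)"
proof -
  have "op_scaleC c A = op_scaleC c id_blinfun o\<^sub>L A"
    by (rule blinfun_eqI) (simp add: op_scaleC_apply)
  then show ?thesis
    using compact_operator_compose_left[OF A] by simp
qed

text \<open>
  Schauder's theorem, from the Hilbert space identity \<open>\<parallel>A\<^sup>* u\<parallel>\<^sup>2 = cinner (A A\<^sup>* u) u\<close>: applied to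
  differences of a bounded sequence along which \<open>A A\<^sup>*\<close> converges, it makes the images under \<open>A\<^sup>*\<close> a
  Cauchy sequence.
\<close>

lemma compact_operator_op_adjoint:
  assumes lin: "complex_linear A" and A: "compact_operator A"
  shows "compact_operator (op_adjoint A)"
  unfolding compact_operator_iff_subseq
proof (intro allI impI)
  fix x :: "nat \<Rightarrow> ell2"
  assume x: "bounded (range x)"
  let ?A' = "op_adjoint A"
  from x obtain b where b: "b > 0" "\<And>n. norm (x n) \<le> b"
    unfolding bounded_pos by auto
  obtain r where r: "strict_mono r"
    "convergent (\<lambda>n. blinfun_apply (A o\<^sub>L ?A') (x (r n)))"
    using compact_operator_compose_right[OF A] x by (rule compact_operator_subseq)
  let ?z = "\<lambda>n. blinfun_apply A (blinfun_apply ?A' (x (r n)))"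
  have key: "(norm (blinfun_apply ?A' (x (r m)) - blinfun_apply ?A' (x (r n))))\<^sup>2
      \<le> norm (?z m - ?z n) * (2 * b)" for m n
  proof -
    let ?u = "x (r m) - x (r n)"
    have "(norm (blinfun_apply ?A' ?u))\<^sup>2 = Re (cinner ?u (blinfun_apply A (blinfun_apply ?A' ?u)))"
      by (simp add: Re_cinner_self flip: op_adjoint(1)[OF lin])
    also have "\<dots> \<le> norm ?u * norm (blinfun_apply A (blinfun_apply ?A' ?u))"
      by (rule order_trans[OF complex_Re_le_cmod cinner_Cauchy_Schwarz])
    also have "\<dots> \<le> (2 * b) * norm (blinfun_apply A (blinfun_apply ?A' ?u))"
      using norm_triangle_ineq4[of "x (r m)" "x (r n)"] b(2)[of "r m"] b(2)[of "r n"]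
      by (intro mult_right_mono) auto
    finally show ?thesis
      by (simp add: blinfun.diff_right mult.commute)
  qed
  have "Cauchy (\<lambda>n. blinfun_apply ?A' (x (r n)))"
  proof (rule metric_CauchyI)
    fix e :: real
    assume e: "e > 0"
    have "Cauchy ?z"
      using r(2) by (simp add: convergent_Cauchy)
    moreover have "e\<^sup>2 / (2 * b) > 0"
      using e b by simp
    ultimately obtain N where N: "\<And>m n. m \<ge> N \<Longrightarrow> n \<ge> N \<Longrightarrow> dist (?z m) (?z n) < e\<^sup>2 / (2 * b)"
      unfolding Cauchy_def by meson
    have "dist (blinfun_apply ?A' (x (r m))) (blinfun_apply ?A' (x (r n))) < e"
      if "m \<ge> N" "n \<ge> N" for m n
    proof -
      have "norm (?z m - ?z n) * (2 * b) < e\<^sup>2"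
        using N[OF that] b(1) by (simp add: dist_norm field_simps)
      with key[of m n] have "(norm (blinfun_apply ?A' (x (r m)) - blinfun_apply ?A' (x (r n))))\<^sup>2 < e\<^sup>2"
        by linarith
      then show ?thesis
        using e by (simp add: dist_norm power2_less_imp_less)
    qed
    then show "\<exists>N. \<forall>m\<ge>N. \<forall>n\<ge>N.
        dist (blinfun_apply ?A' (x (r m))) (blinfun_apply ?A' (x (r n))) < e"
      by blast
  qed
  then show "\<exists>r. strict_mono r \<and> convergent (\<lambda>n. blinfun_apply ?A' (x (r n)))"
    using r(1) Cauchy_convergent by blast
qed

lemma truncate_truncate: "truncate k (truncate l x) = truncate (min k l) x"
  by (rule ell2_eqI) (simp add: truncate.rep_eq)

lemma truncate_zero_size: "truncate 0 x = 0"
  by (rule ell2_eqI) (simp add: truncate.rep_eq zero_ell2.rep_eq)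

lemma truncate_zero: "truncate k 0 = 0"
  by (rule ell2_eqI) (simp add: truncate.rep_eq zero_ell2.rep_eq)

lemma truncate_add: "truncate k (x + y) = truncate k x + truncate k y"
  by (rule ell2_eqI) (simp add: truncate.rep_eq plus_ell2.rep_eq)

lemma truncate_scaleC: "truncate k (c *\<^sub>C x) = c *\<^sub>C truncate k x"
  by (rule ell2_eqI) (simp add: truncate.rep_eq scaleC.rep_eq)

lemma cinner_truncate: "cinner (truncate k x) y = cinner x (truncate k y)"
  unfolding cinner_def by (rule arg_cong[of _ _ suminf]) (auto simp: truncate.rep_eq)

text \<open>
  Since truncation is idempotent, the support condition splits into invariance under truncation on
  the left and on the right. Products inherit these two conditions from the outer factors, and taking
  adjoints exchanges them.
\<close>

lemma M_iff:
  "A \<in> M k \<longleftrightarrow> complex_linear A \<and> compact_operator A \<and>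
    (\<forall>x. truncate k (blinfun_apply A x) = blinfun_apply A x) \<and>
    (\<forall>x. blinfun_apply A (truncate k x) = blinfun_apply A x)"
proof -
  have "(\<forall>x. f x = truncate k (f (truncate k x))) \<longleftrightarrow>
      (\<forall>x. truncate k (f x) = f x) \<and> (\<forall>x. f (truncate k x) = f x)" for f :: "ell2 \<Rightarrow> ell2"
  proof (intro iffI conjI allI)
    fix x
    assume *: "\<forall>x. f x = truncate k (f (truncate k x))"
    show "truncate k (f x) = f x"
      unfolding *[rule_format, of x] by (simp add: truncate_truncate)
    show "f (truncate k x) = f x"
      unfolding *[rule_format, of x] *[rule_format, of "truncate k x"]
      by (simp add: truncate_truncate)
  qed simp
  then show ?thesis
    unfolding M_def by simp
qed

lemma M_complex_linear: "A \<in> M k \<Longrightarrow> complex_linear A"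
  by (simp add: M_iff)

lemma zero_in_M: "0 \<in> M k"
proof -
  have "compact_operator 0"
    unfolding compact_operator_iff_subseq by (auto intro: strict_mono_id convergent_const)
  then show ?thesis
    by (simp add: M_iff complex_linear_def truncate_zero scaleC_zero_right)
qed

lemma M_zero_size: "M 0 = {0}"
proof (rule antisym)
  show "M 0 \<subseteq> {0}"
  proof
    fix A assume "A \<in> M 0"
    then have "blinfun_apply A x = 0" for x
      unfolding M_iff truncate_zero_size by metis
    then show "A \<in> {0}"
      by (auto intro: blinfun_eqI)
  qed
qed (simp add: zero_in_M)

lemma M_add: "A \<in> M k \<Longrightarrow> B \<in> M k \<Longrightarrow> A + B \<in> M k"
  by (simp add: M_iff complex_linear_add compact_operator_add blinfun.add_left truncate_add)

lemma M_op_scaleC: "A \<in> M k \<Longrightarrow> op_scaleC c A \<in> M k"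
  by (simp add: M_iff complex_linear_op_scaleC compact_operator_op_scaleC op_scaleC_apply
      truncate_scaleC)

lemma M_scaleR: "A \<in> M k \<Longrightarrow> r *\<^sub>R A \<in> M k"
  using M_op_scaleC[of A k "complex_of_real r"] by (simp add: op_scaleC_of_real)

lemma M_compose: "A \<in> M k \<Longrightarrow> B \<in> M k \<Longrightarrow> A o\<^sub>L B \<in> M k"
  by (simp add: M_iff complex_linear_compose compact_operator_compose_left)

lemma M_op_adjoint: "A \<in> M k \<Longrightarrow> op_adjoint A \<in> M k"
  by (auto simp: M_iff complex_linear_op_adjoint compact_operator_op_adjoint op_adjoint
      cinner_truncate intro!: cinner_eqI)

lemma M_mono:
  assumes "A \<in> M k" "k \<le> l"
  shows "A \<in> M l"
proof -
  have "truncate l (truncate k x) = truncate k x" "truncate k (truncate l x) = truncate k x" for x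
    using assms(2) by (simp_all add: truncate_truncate min_absorb1 min_absorb2)
  then show ?thesis
    using assms(1) unfolding M_iff by metis
qed

section \<open>Quotients of pointwise algebras\<close>

locale pointwise_ideal =
  fixes S I :: "('i \<Rightarrow> ell2 \<Rightarrow>\<^sub>L ell2) set"
  assumes complex_linear_values: "f \<in> S \<Longrightarrow> complex_linear (f t)"
    and bounded_range: "f \<in> S \<Longrightarrow> bounded (range f)"
    and S_add: "f \<in> S \<Longrightarrow> g \<in> S \<Longrightarrow> (\<lambda>t. f t + g t) \<in> S"
    and S_scale: "f \<in> S \<Longrightarrow> (\<lambda>t. op_scaleC c (f t)) \<in> S"
    and S_mult: "f \<in> S \<Longrightarrow> g \<in> S \<Longrightarrow> (\<lambda>t. f t o\<^sub>L g t) \<in> S"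
    and S_star: "f \<in> S \<Longrightarrow> (\<lambda>t. op_adjoint (f t)) \<in> S"
    and I_subset: "I \<subseteq> S"
    and I_zero: "(\<lambda>t. 0) \<in> I"
    and I_add: "u \<in> I \<Longrightarrow> v \<in> I \<Longrightarrow> (\<lambda>t. u t + v t) \<in> I"
    and I_scale: "u \<in> I \<Longrightarrow> (\<lambda>t. op_scaleC c (u t)) \<in> I"
    and I_mult_left: "f \<in> S \<Longrightarrow> u \<in> I \<Longrightarrow> (\<lambda>t. f t o\<^sub>L u t) \<in> I"
    and I_mult_right: "f \<in> S \<Longrightarrow> u \<in> I \<Longrightarrow> (\<lambda>t. u t o\<^sub>L f t) \<in> I"
    and I_star: "u \<in> I \<Longrightarrow> (\<lambda>t. op_adjoint (u t)) \<in> I"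
begin

abbreviation cls :: "('i \<Rightarrow> ell2 \<Rightarrow>\<^sub>L ell2) \<Rightarrow> ('i \<Rightarrow> ell2 \<Rightarrow>\<^sub>L ell2) set" where
  "cls \<equiv> coset (pointwise_algebra S) I"

lemma I_minus: "u \<in> I \<Longrightarrow> (\<lambda>t. - u t) \<in> I"
  using I_scale[of u "complex_of_real (- 1)"] unfolding op_scaleC_of_real by simp

lemma I_diff: "u \<in> I \<Longrightarrow> v \<in> I \<Longrightarrow> (\<lambda>t. u t - v t) \<in> I"
  using I_add[OF _ I_minus, of u v] by simp

lemma mem_cls: "g \<in> cls f \<longleftrightarrow> (\<lambda>t. g t - f t) \<in> I"
proof
  assume "(\<lambda>t. g t - f t) \<in> I"
  then show "g \<in> cls f"
    by (auto simp: coset_def pointwise_algebra_def intro!: rev_image_eqI)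
qed (auto simp: coset_def pointwise_algebra_def)

lemma self_mem_cls: "f \<in> cls f"
  by (simp add: mem_cls I_zero)

lemma cls_subset: "f \<in> S \<Longrightarrow> cls f \<subseteq> S"
  using S_add I_subset by (auto simp: coset_def pointwise_algebra_def)

lemma cls_eqI:
  assumes "(\<lambda>t. f t - g t) \<in> I"
  shows "cls f = cls g"
proof (intro set_eqI iffI)
  fix u
  show "u \<in> cls g" if "u \<in> cls f"
    using I_add[OF that[unfolded mem_cls] assms] by (simp add: mem_cls)
  show "u \<in> cls f" if "u \<in> cls g"
    using I_diff[OF that[unfolded mem_cls] assms] by (simp add: mem_cls)
qed

lemma cls_eq: "g \<in> cls f \<Longrightarrow> cls g = cls f"
  unfolding mem_cls by (rule cls_eqI)

lemma UN_eq_const: "x \<in> X \<Longrightarrow> (\<And>x. x \<in> X \<Longrightarrow> F x = C) \<Longrightarrow> (\<Union>x\<in>X. F x) = C"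
  by auto

lemma quotient_carrier: "carrier (quotient_algebra (pointwise_algebra S) I) = cls ` S"
  by (simp add: quotient_algebra_def pointwise_algebra_def)

lemma quotient_add:
  "add (quotient_algebra (pointwise_algebra S) I) (cls f) (cls g) = cls (\<lambda>t. f t + g t)"
proof -
  have "cls (\<lambda>t. x t + y t) = cls (\<lambda>t. f t + g t)" if "x \<in> cls f" "y \<in> cls g" for x y
    using I_add[OF that[unfolded mem_cls]] by (intro cls_eqI) (simp add: algebra_simps)
  then have "(\<Union>x\<in>cls f. \<Union>y\<in>cls g. cls (\<lambda>t. x t + y t)) = cls (\<lambda>t. f t + g t)"
    by (intro UN_eq_const[OF self_mem_cls])
  then show ?thesis
    by (simp add: quotient_algebra_def) (simp add: pointwise_algebra_def)
qed

lemma quotient_scale: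
  "scale (quotient_algebra (pointwise_algebra S) I) c (cls f) = cls (\<lambda>t. op_scaleC c (f t))"
proof -
  have "cls (\<lambda>t. op_scaleC c (x t)) = cls (\<lambda>t. op_scaleC c (f t))" if "x \<in> cls f" for x
    using I_scale[OF that[unfolded mem_cls], of c] by (intro cls_eqI) (simp add: op_scaleC_diff)
  then have "(\<Union>x\<in>cls f. cls (\<lambda>t. op_scaleC c (x t))) = cls (\<lambda>t. op_scaleC c (f t))"
    by (intro UN_eq_const[OF self_mem_cls])
  then show ?thesis
    by (simp add: quotient_algebra_def) (simp add: pointwise_algebra_def)
qed

lemma quotient_mult:
  assumes f: "f \<in> S" and g: "g \<in> S"
  shows "mult (quotient_algebra (pointwise_algebra S) I) (cls f) (cls g) = cls (\<lambda>t. f t o\<^sub>L g t)"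
proof -
  have "cls (\<lambda>t. x t o\<^sub>L y t) = cls (\<lambda>t. f t o\<^sub>L g t)" if x: "x \<in> cls f" and y: "y \<in> cls g" for x y
  proof (rule cls_eqI)
    have "(\<lambda>t. (x t - f t) o\<^sub>L y t) \<in> I" "(\<lambda>t. f t o\<^sub>L (y t - g t)) \<in> I"
      using I_mult_right[OF subsetD[OF cls_subset[OF g] y] x[unfolded mem_cls]]
        I_mult_left[OF f y[unfolded mem_cls]] .
    from I_add[OF this] show "(\<lambda>t. (x t o\<^sub>L y t) - (f t o\<^sub>L g t)) \<in> I"
      by (simp add: bounded_bilinear.diff_left[OF bounded_bilinear_blinfun_compose]
          bounded_bilinear.diff_right[OF bounded_bilinear_blinfun_compose])
  qed
  then have "(\<Union>x\<in>cls f. \<Union>y\<in>cls g. cls (\<lambda>t. x t o\<^sub>L y t)) = cls (\<lambda>t. f t o\<^sub>L g t)"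
    by (intro UN_eq_const[OF self_mem_cls])
  then show ?thesis
    by (simp add: quotient_algebra_def) (simp add: pointwise_algebra_def)
qed

lemma quotient_star:
  assumes f: "f \<in> S"
  shows "star (quotient_algebra (pointwise_algebra S) I) (cls f) = cls (\<lambda>t. op_adjoint (f t))"
proof -
  have "cls (\<lambda>t. op_adjoint (x t)) = cls (\<lambda>t. op_adjoint (f t))" if x: "x \<in> cls f" for x
  proof (rule cls_eqI)
    have "complex_linear (x t)" "complex_linear (f t)" for t
      using x cls_subset[OF f] f by (auto intro: complex_linear_values)
    then show "(\<lambda>t. op_adjoint (x t) - op_adjoint (f t)) \<in> I"
      using I_star[OF x[unfolded mem_cls]] by (simp add: op_adjoint_diff)
  qed
  then have "(\<Union>x\<in>cls f. cls (\<lambda>t. op_adjoint (x t))) = cls (\<lambda>t. op_adjoint (f t))"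
    by (intro UN_eq_const[OF self_mem_cls])
  then show ?thesis
    by (simp add: quotient_algebra_def) (simp add: pointwise_algebra_def)
qed

lemma quotient_nrm:
  "nrm (quotient_algebra (pointwise_algebra S) I) X = (INF f\<in>X. SUP t. norm (f t))"
  by (simp add: quotient_algebra_def pointwise_algebra_def)

lemma norm_le_SUP:
  assumes "f \<in> S"
  shows "norm (f t) \<le> (SUP t. norm (f t))"
proof -
  obtain b where "\<And>t. norm (f t) \<le> b"
    using bounded_range[OF assms] by (auto simp: bounded_iff)
  then show ?thesis
    by (intro cSUP_upper bdd_aboveI2) auto
qed

lemma SUP_norm_nonneg: "f \<in> S \<Longrightarrow> 0 \<le> (SUP t. norm (f t))"
  by (rule order_trans[OF norm_ge_zero norm_le_SUP])

end

text \<open>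
  Reindexing \<open>R f = f \<circ> h\<close> is automatically a contractive \<open>*\<close>-homomorphism. If it identifies \<open>J\<close>
  with the preimage of \<open>I\<close> and is surjective modulo \<open>I\<close>, it induces an isomorphism of the quotients,
  and the inverse isomorphism sends a class to its full preimage under \<open>R\<close>. A contractive map \<open>E\<close> that
  inverts \<open>R\<close> modulo \<open>I\<close> on the right yields both the surjectivity and, since it picks in each class of
  \<open>T\<close> a representative no larger than a given one in the class of \<open>S\<close>, the equality of quotient norms.
\<close>

lemma quotient_star_isomorphic_of_reindexing:
  fixes S I :: "('i \<Rightarrow> ell2 \<Rightarrow>\<^sub>L ell2) set" and T J :: "('j \<Rightarrow> ell2 \<Rightarrow>\<^sub>L ell2) set"
    and h :: "'i \<Rightarrow> 'j" and E :: "('i \<Rightarrow> ell2 \<Rightarrow>\<^sub>L ell2) \<Rightarrow> 'j \<Rightarrow> ell2 \<Rightarrow>\<^sub>L ell2"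
  assumes S: "pointwise_ideal S I" and T: "pointwise_ideal T J"
    and R: "\<And>f. f \<in> T \<Longrightarrow> (\<lambda>i. f (h i)) \<in> S"
    and J: "J = {f \<in> T. (\<lambda>i. f (h i)) \<in> I}"
    and E: "\<And>m. m \<in> S \<Longrightarrow> E m \<in> T" "\<And>m. m \<in> S \<Longrightarrow> (\<lambda>i. E m (h i) - m i) \<in> I"
    and E_le: "\<And>m t. m \<in> S \<Longrightarrow> norm (E m t) \<le> (SUP i. norm (m i))"
  shows "quotient_algebra (pointwise_algebra S) I \<cong>\<^sup>* quotient_algebra (pointwise_algebra T) J"
proof -
  interpret S: pointwise_ideal S I by (rule S)
  interpret T: pointwise_ideal T J by (rule T)
  let ?A = "quotient_algebra (pointwise_algebra S) I"
  let ?B = "quotient_algebra (pointwise_algebra T) J"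
  define R where "R f = (\<lambda>i. f (h i))" for f :: "'j \<Rightarrow> ell2 \<Rightarrow>\<^sub>L ell2"
  define \<phi> where "\<phi> X = {f \<in> T. R f \<in> X}" for X
  have R_S: "R f \<in> S" if "f \<in> T" for f
    using assms(3)[OF that] by (simp add: R_def)
  have T_diff: "(\<lambda>t. f t - g t) \<in> T" if "f \<in> T" "g \<in> T" for f g
    using T.S_add[OF that(1) T.S_scale[OF that(2), of "complex_of_real (- 1)"]]
    unfolding op_scaleC_of_real by simp
  have \<phi>_cls: "\<phi> (S.cls (R f)) = T.cls f" if f: "f \<in> T" for f
  proof (intro set_eqI iffI)
    fix g
    assume "g \<in> \<phi> (S.cls (R f))"
    then have "(\<lambda>t. g t - f t) \<in> J"
      using T_diff[of g f] f by (simp add: \<phi>_def S.mem_cls R_def) (simp add: J)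
    then show "g \<in> T.cls f"
      by (simp add: T.mem_cls)
  next
    fix g
    assume g: "g \<in> T.cls f"
    then have "g \<in> T"
      using T.cls_subset[OF f] by blast
    moreover have "(\<lambda>i. g (h i) - f (h i)) \<in> I"
      using g[unfolded T.mem_cls] unfolding J by simp
    ultimately show "g \<in> \<phi> (S.cls (R f))"
      by (simp add: \<phi>_def S.mem_cls R_def)
  qed
  have E_cls: "R (E m) \<in> S.cls m" if "m \<in> S" for m
    using E(2)[OF that] by (simp add: S.mem_cls R_def)
  (* Each class of S thus has a representative of the form R f; all operations are compared on these,
     where R commutes with them by definition. *)
  have lift: "\<exists>f\<in>T. X = S.cls (R f)" if "X \<in> carrier ?A" for X
    using that E(1) S.cls_eq[OF E_cls] unfolding S.quotient_carrier by blast
  have "bij_betw \<phi> (carrier ?A) (carrier ?B)"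
    unfolding bij_betw_def
  proof
    show "inj_on \<phi> (carrier ?A)"
    proof (rule inj_onI)
      fix X Y
      assume X: "X \<in> carrier ?A" and Y: "Y \<in> carrier ?A" and eq: "\<phi> X = \<phi> Y"
      obtain f where f: "f \<in> T" "X = S.cls (R f)"
        using lift[OF X] by blast
      obtain g where g: "g \<in> T" "Y = S.cls (R g)"
        using lift[OF Y] by blast
      have "f \<in> \<phi> X"
        using f S.self_mem_cls by (simp add: \<phi>_def)
      then have "R f \<in> S.cls (R g)"
        unfolding eq by (simp add: \<phi>_def g)
      then show "X = Y"
        using S.cls_eq f g by simp
    qed
    show "\<phi> ` carrier ?A = carrier ?B"
    proof
      show "\<phi> ` carrier ?A \<subseteq> carrier ?B"
        using lift \<phi>_cls by (force simp: T.quotient_carrier)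
      show "carrier ?B \<subseteq> \<phi> ` carrier ?A"
      proof
        fix Y
        assume "Y \<in> carrier ?B"
        then obtain f where f: "f \<in> T" "Y = T.cls f"
          by (auto simp: T.quotient_carrier)
        then have "Y = \<phi> (S.cls (R f))" "S.cls (R f) \<in> carrier ?A"
          using \<phi>_cls R_S by (auto simp: S.quotient_carrier)
        then show "Y \<in> \<phi> ` carrier ?A"
          by blast
      qed
    qed
  qed
  moreover have "\<phi> (add ?A X Y) = add ?B (\<phi> X) (\<phi> Y)"
    if XY: "X \<in> carrier ?A" "Y \<in> carrier ?A" for X Y
  proof -
    obtain f g where fg: "f \<in> T" "X = S.cls (R f)" "g \<in> T" "Y = S.cls (R g)"
      using lift[OF XY(1)] lift[OF XY(2)] by blast
    then have "add ?A X Y = S.cls (R (\<lambda>t. f t + g t))"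
      by (simp add: S.quotient_add) (simp add: R_def)
    with fg show ?thesis
      by (simp add: \<phi>_cls T.S_add T.quotient_add)
  qed
  moreover have "\<phi> (mult ?A X Y) = mult ?B (\<phi> X) (\<phi> Y)"
    if XY: "X \<in> carrier ?A" "Y \<in> carrier ?A" for X Y
  proof -
    obtain f g where fg: "f \<in> T" "X = S.cls (R f)" "g \<in> T" "Y = S.cls (R g)"
      using lift[OF XY(1)] lift[OF XY(2)] by blast
    then have "mult ?A X Y = S.cls (R (\<lambda>t. f t o\<^sub>L g t))"
      by (simp add: S.quotient_mult R_S) (simp add: R_def)
    with fg show ?thesis
      by (simp add: \<phi>_cls T.S_mult T.quotient_mult)
  qed
  moreover have "\<phi> (scale ?A c X) = scale ?B c (\<phi> X)" if X: "X \<in> carrier ?A" for c X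
  proof -
    obtain f where f: "f \<in> T" "X = S.cls (R f)"
      using lift[OF X] by blast
    then have "scale ?A c X = S.cls (R (\<lambda>t. op_scaleC c (f t)))"
      by (simp add: S.quotient_scale) (simp add: R_def)
    with f show ?thesis
      by (simp add: \<phi>_cls T.S_scale T.quotient_scale)
  qed
  moreover have "\<phi> (star ?A X) = star ?B (\<phi> X)" if X: "X \<in> carrier ?A" for X
  proof -
    obtain f where f: "f \<in> T" "X = S.cls (R f)"
      using lift[OF X] by blast
    then have "star ?A X = S.cls (R (\<lambda>t. op_adjoint (f t)))"
      by (simp add: S.quotient_star R_S) (simp add: R_def)
    with f show ?thesis
      by (simp add: \<phi>_cls T.S_star T.quotient_star)
  qed
  moreover have "nrm ?B (\<phi> X) = nrm ?A X" if X: "X \<in> carrier ?A" for X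
  proof -
    have X_S: "X \<subseteq> S"
      using X S.cls_subset by (auto simp: S.quotient_carrier)
    have E_\<phi>: "E m \<in> \<phi> X" if m: "m \<in> X" for m
    proof -
      obtain a where "X = S.cls a"
        using X by (auto simp: S.quotient_carrier)
      then have "X = S.cls m"
        using m S.cls_eq by blast
      then show ?thesis
        using E_cls[of m] E(1)[of m] m X_S by (auto simp: \<phi>_def)
    qed
    obtain m0 where m0: "m0 \<in> X"
      using X S.self_mem_cls by (auto simp: S.quotient_carrier)
    have R_le: "(SUP i. norm (R f i)) \<le> (SUP t. norm (f t))" if "f \<in> T" for f
      using T.norm_le_SUP[OF that] by (intro cSUP_least) (auto simp: R_def)
    have E_SUP_le: "(SUP t. norm (E m t)) \<le> (SUP i. norm (m i))" if "m \<in> S" for m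
      using E_le[OF that] by (intro cSUP_least) auto
    have "(INF f\<in>\<phi> X. SUP t. norm (f t)) \<le> (INF m\<in>X. SUP i. norm (m i))"
    proof (rule cINF_mono)
      show "bdd_below ((\<lambda>f. SUP t. norm (f t)) ` \<phi> X)"
        using T.SUP_norm_nonneg by (intro bdd_belowI[of _ 0]) (auto simp: \<phi>_def)
      show "\<exists>f\<in>\<phi> X. (SUP t. norm (f t)) \<le> (SUP i. norm (m i))" if "m \<in> X" for m
        using that E_\<phi> E_SUP_le X_S by blast
    qed (use m0 in blast)
    moreover have "(INF m\<in>X. SUP i. norm (m i)) \<le> (INF f\<in>\<phi> X. SUP t. norm (f t))"
    proof (rule cINF_mono)
      show "bdd_below ((\<lambda>m. SUP i. norm (m i)) ` X)"
        using S.SUP_norm_nonneg X_S by (intro bdd_belowI[of _ 0]) auto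
      show "\<exists>m\<in>X. (SUP i. norm (m i)) \<le> (SUP t. norm (f t))" if "f \<in> \<phi> X" for f
        using that R_le by (auto simp: \<phi>_def)
    qed (use m0 E_\<phi> in blast)
    ultimately show ?thesis
      by (simp add: S.quotient_nrm T.quotient_nrm)
  qed
  ultimately show ?thesis
    unfolding star_isomorphic_def star_isomorphism_def by blast
qed

section \<open>Slowly varying operator functions\<close>

text \<open>
  Both \<open>B_set\<close> and \<open>Cvv_set\<close> consist of bounded functions with values in prescribed matrix algebras
  and with \<open>f s - f t\<close> tending to \<open>0\<close> along a filter of pairs \<open>(s, t)\<close>: pairs of consecutive indices
  for sequences, pairs at distance at most \<open>1\<close> for functions on the half-line. Continuity is required
  on a set \<open>D\<close>, which is empty for sequences. The conventions at index \<open>0\<close> and at negative arguments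
  are the constraint that the value lies in \<open>M 0 = {0}\<close>.
\<close>

definition slow_functions ::
    "('i :: topological_space \<Rightarrow> enat) \<Rightarrow> 'i set \<Rightarrow> ('i \<times> 'i) filter \<Rightarrow> ('i \<Rightarrow> ell2 \<Rightarrow>\<^sub>L ell2) set" where
  "slow_functions k D F = {f. (\<forall>t. f t \<in> M (k t)) \<and> continuous_on D f \<and> bounded (range f) \<and>
    ((\<lambda>(s, t). f s - f t) \<longlongrightarrow> 0) F}"

definition slow_ideal ::
    "('i :: topological_space \<Rightarrow> enat) \<Rightarrow> 'i set \<Rightarrow> ('i \<times> 'i) filter \<Rightarrow> 'i filter \<Rightarrow>
      ('i \<Rightarrow> ell2 \<Rightarrow>\<^sub>L ell2) set" where
  "slow_ideal k D F G = {f \<in> slow_functions k D F. (f \<longlongrightarrow> 0) G}"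

lemma bounded_linear_op_scaleC: "bounded_linear (op_scaleC c)"
proof (rule bounded_linear_intro)
  show "op_scaleC c (r *\<^sub>R A) = r *\<^sub>R op_scaleC c A" for r A
    by (rule blinfun_eqI)
      (simp add: op_scaleC_apply blinfun.scaleR_left scaleR_ell2_def scaleC_scaleC mult.commute)
  show "norm (op_scaleC c A) \<le> norm A * cmod c" for A
    using norm_op_scaleC_le[of c A] by (simp add: mult.commute)
qed (rule op_scaleC_add)

lemma bounded_range_normD: "bounded (range f) \<Longrightarrow> \<exists>b. \<forall>t. norm (f t) \<le> b"
  by (simp add: bounded_iff)

lemma bounded_range_normI: "(\<And>t. norm (f t) \<le> b) \<Longrightarrow> bounded (range f)"
  by (auto simp: bounded_iff)

lemma tendsto_zero_compose_left:
  assumes "bounded (range f)" "(g \<longlongrightarrow> 0) F"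
  shows "((\<lambda>x. f (u x) o\<^sub>L g x) \<longlongrightarrow> (0 :: ell2 \<Rightarrow>\<^sub>L ell2)) F"
proof -
  obtain b where b: "\<And>t. norm (f t) \<le> b"
    using bounded_range_normD[OF assms(1)] by blast
  have le: "norm (f (u x) o\<^sub>L g x) \<le> b * norm (g x)" for x
    by (rule order_trans[OF norm_blinfun_compose mult_right_mono[OF b]]) simp
  have lim: "((\<lambda>x. b * norm (g x)) \<longlongrightarrow> 0) F"
    using tendsto_mult_left[OF tendsto_norm_zero[OF assms(2)], of b] by simp
  show ?thesis
    by (rule Lim_null_comparison[OF always_eventually lim]) (simp add: le)
qed

lemma tendsto_zero_compose_right:
  assumes "bounded (range f)" "(g \<longlongrightarrow> 0) F"
  shows "((\<lambda>x. g x o\<^sub>L f (u x)) \<longlongrightarrow> (0 :: ell2 \<Rightarrow>\<^sub>L ell2)) F"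
proof -
  obtain b where b: "\<And>t. norm (f t) \<le> b"
    using bounded_range_normD[OF assms(1)] by blast
  have le: "norm (g x o\<^sub>L f (u x)) \<le> norm (g x) * b" for x
    by (rule order_trans[OF norm_blinfun_compose mult_left_mono[OF b]]) simp
  have lim: "((\<lambda>x. norm (g x) * b) \<longlongrightarrow> 0) F"
    using tendsto_mult_right[OF tendsto_norm_zero[OF assms(2)], of b] by simp
  show ?thesis
    by (rule Lim_null_comparison[OF always_eventually lim]) (simp add: le)
qed

lemma tendsto_zero_op_scaleC: "(f \<longlongrightarrow> 0) F \<Longrightarrow> ((\<lambda>x. op_scaleC c (f x)) \<longlongrightarrow> 0) F"
  using bounded_linear.tendsto_zero[OF bounded_linear_op_scaleC] .

lemma tendsto_zero_op_adjoint:
  assumes "\<And>x. complex_linear (f x)" "(f \<longlongrightarrow> 0) F"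
  shows "((\<lambda>x. op_adjoint (f x)) \<longlongrightarrow> 0) F"
  by (rule Lim_null_comparison[OF always_eventually tendsto_norm_zero[OF assms(2)]])
    (simp add: op_adjoint(2)[OF assms(1)])

lemma complex_linear_diff: "complex_linear A \<Longrightarrow> complex_linear B \<Longrightarrow> complex_linear (A - B)"
  by (simp add: complex_linear_def blinfun.diff_left scaleC_diff_right)

lemma continuous_on_op_adjoint:
  fixes f :: "'i :: topological_space \<Rightarrow> ell2 \<Rightarrow>\<^sub>L ell2"
  assumes lin: "\<And>t. complex_linear (f t)" and f: "continuous_on D f"
  shows "continuous_on D (\<lambda>t. op_adjoint (f t))"
  unfolding continuous_on_def
proof
  fix x
  assume "x \<in> D"
  then have "((\<lambda>t. f t - f x) \<longlongrightarrow> 0) (at x within D)"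
    using f by (simp add: continuous_on_def LIM_zero)
  then have "((\<lambda>t. op_adjoint (f t - f x)) \<longlongrightarrow> 0) (at x within D)"
    by (intro tendsto_zero_op_adjoint complex_linear_diff lin)
  then show "((\<lambda>t. op_adjoint (f t)) \<longlongrightarrow> op_adjoint (f x)) (at x within D)"
    by (intro LIM_zero_cancel[of "\<lambda>t. op_adjoint (f t)"]) (simp add: op_adjoint_diff lin)
qed

lemma slow_functions_bounded: "f \<in> slow_functions k D F \<Longrightarrow> \<exists>b. \<forall>t. norm (f t) \<le> b"
  by (simp add: slow_functions_def bounded_range_normD)

lemma slow_functions_add:
  assumes f: "f \<in> slow_functions k D F" and g: "g \<in> slow_functions k D F"
  shows "(\<lambda>t. f t + g t) \<in> slow_functions k D F"
proof -
  have "((\<lambda>p. (case p of (s, t) \<Rightarrow> f s - f t) + (case p of (s, t) \<Rightarrow> g s - g t)) \<longlongrightarrow> 0 + 0) F"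
    using f g by (intro tendsto_add) (simp_all add: slow_functions_def)
  then have slow: "((\<lambda>(s, t). f s + g s - (f t + g t)) \<longlongrightarrow> 0) F"
    by (simp add: case_prod_beta' algebra_simps)
  obtain a where a: "\<And>t. norm (f t) \<le> a"
    using slow_functions_bounded[OF f] by blast
  obtain b where b: "\<And>t. norm (g t) \<le> b"
    using slow_functions_bounded[OF g] by blast
  have bdd: "bounded (range (\<lambda>t. f t + g t))"
    by (intro bounded_range_normI[of _ "a + b"] norm_triangle_le add_mono a b)
  show ?thesis
    using f g slow bdd by (simp add: slow_functions_def M_add continuous_on_add)
qed

lemma slow_functions_scale:
  assumes f: "f \<in> slow_functions k D F"
  shows "(\<lambda>t. op_scaleC c (f t)) \<in> slow_functions k D F"
proof -
  have "((\<lambda>p. op_scaleC c (case p of (s, t) \<Rightarrow> f s - f t)) \<longlongrightarrow> 0) F"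
    using f by (intro tendsto_zero_op_scaleC) (simp add: slow_functions_def)
  then have "((\<lambda>(s, t). op_scaleC c (f s) - op_scaleC c (f t)) \<longlongrightarrow> 0) F"
    by (simp add: case_prod_beta' op_scaleC_diff)
  moreover have "bounded (range (\<lambda>t. op_scaleC c (f t)))"
    using f bounded_linear_image[OF _ bounded_linear_op_scaleC[of c], of "range f"]
    by (simp add: slow_functions_def image_image)
  ultimately show ?thesis
    using f by (simp add: slow_functions_def M_op_scaleC
        bounded_linear.continuous_on[OF bounded_linear_op_scaleC])
qed

lemma slow_functions_mult:
  assumes f: "f \<in> slow_functions k D F" and g: "g \<in> slow_functions k D F"
  shows "(\<lambda>t. f t o\<^sub>L g t) \<in> slow_functions k D F"
proof -
  (* f s o g s - f t o g t = f s o (g s - g t) + (f s - f t) o g t *)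
  have "((\<lambda>p. (f (fst p) o\<^sub>L (g (fst p) - g (snd p))) + ((f (fst p) - f (snd p)) o\<^sub>L g (snd p)))
      \<longlongrightarrow> 0 + 0) F"
    using f g by (intro tendsto_add tendsto_zero_compose_left tendsto_zero_compose_right)
      (simp_all add: slow_functions_def case_prod_beta')
  then have slow: "((\<lambda>(s, t). (f s o\<^sub>L g s) - (f t o\<^sub>L g t)) \<longlongrightarrow> 0) F"
    by (simp add: case_prod_beta' bounded_bilinear.diff_left[OF bounded_bilinear_blinfun_compose]
        bounded_bilinear.diff_right[OF bounded_bilinear_blinfun_compose])
  obtain a where a: "\<And>t. norm (f t) \<le> a"
    using slow_functions_bounded[OF f] by blast
  obtain b where b: "\<And>t. norm (g t) \<le> b"
    using slow_functions_bounded[OF g] by blast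
  have bdd: "bounded (range (\<lambda>t. f t o\<^sub>L g t))"
    by (intro bounded_range_normI[of _ "a * b"] order_trans[OF norm_blinfun_compose] mult_mono a b
        norm_ge_zero order_trans[OF norm_ge_zero a])
  have "continuous_on D (\<lambda>t. f t o\<^sub>L g t)"
    using f g by (intro bounded_bilinear.continuous_on[OF bounded_bilinear_blinfun_compose])
      (simp_all add: slow_functions_def)
  then show ?thesis
    using f g slow bdd by (simp add: slow_functions_def M_compose)
qed

lemma slow_functions_star:
  assumes f: "f \<in> slow_functions k D F"
  shows "(\<lambda>t. op_adjoint (f t)) \<in> slow_functions k D F"
proof -
  have lin: "complex_linear (f t)" for t
    using f by (auto simp: slow_functions_def intro: M_complex_linear)
  have "((\<lambda>p. op_adjoint (f (fst p) - f (snd p))) \<longlongrightarrow> 0) F"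
    using f by (intro tendsto_zero_op_adjoint complex_linear_diff lin)
      (simp add: slow_functions_def case_prod_beta')
  then have "((\<lambda>(s, t). op_adjoint (f s) - op_adjoint (f t)) \<longlongrightarrow> 0) F"
    by (simp add: case_prod_beta' op_adjoint_diff lin)
  moreover obtain a where "\<And>t. norm (f t) \<le> a"
    using slow_functions_bounded[OF f] by blast
  then have "bounded (range (\<lambda>t. op_adjoint (f t)))"
    by (intro bounded_range_normI[of _ a] order_trans[OF op_adjoint(2)[OF lin]])
  ultimately show ?thesis
    using f by (simp add: slow_functions_def M_op_adjoint continuous_on_op_adjoint lin)
qed

lemma pointwise_ideal_slow: "pointwise_ideal (slow_functions k D F) (slow_ideal k D F G)"
proof
  fix f g u v :: "'a \<Rightarrow> ell2 \<Rightarrow>\<^sub>L ell2" and c :: complex and t :: 'a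
  let ?S = "slow_functions k D F" and ?I = "slow_ideal k D F G"
  show lin: "complex_linear (f t)" if "f \<in> ?S" for f t
    using that by (auto simp: slow_functions_def intro: M_complex_linear)
  show bdd: "bounded (range f)" if "f \<in> ?S" for f
    using that by (simp add: slow_functions_def)
  show "?I \<subseteq> ?S"
    by (auto simp: slow_ideal_def)
  show "(\<lambda>t. 0) \<in> ?I"
    by (auto simp: slow_ideal_def slow_functions_def zero_in_M image_constant_conv case_prod_beta')
  show "(\<lambda>t. u t + v t) \<in> ?I" if "u \<in> ?I" "v \<in> ?I"
    using that slow_functions_add tendsto_add[of u 0 G v 0] by (auto simp: slow_ideal_def)
  show "(\<lambda>t. op_scaleC c (u t)) \<in> ?I" if "u \<in> ?I"
    using that slow_functions_scale tendsto_zero_op_scaleC by (auto simp: slow_ideal_def)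
  show "(\<lambda>t. f t o\<^sub>L u t) \<in> ?I" if "f \<in> ?S" "u \<in> ?I"
    using that slow_functions_mult tendsto_zero_compose_left[OF bdd[OF that(1)], of u G "\<lambda>x. x"]
    by (auto simp: slow_ideal_def)
  show "(\<lambda>t. u t o\<^sub>L f t) \<in> ?I" if "f \<in> ?S" "u \<in> ?I"
    using that slow_functions_mult tendsto_zero_compose_right[OF bdd[OF that(1)], of u G "\<lambda>x. x"]
    by (auto simp: slow_ideal_def)
  show "(\<lambda>t. op_adjoint (u t)) \<in> ?I" if "u \<in> ?I"
    using that slow_functions_star tendsto_zero_op_adjoint[of u G] lin
    by (auto simp: slow_ideal_def)
qed (fact slow_functions_add slow_functions_scale slow_functions_mult slow_functions_star)+

definition consecutive :: "(nat \<times> nat) filter" where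
  "consecutive = filtermap (\<lambda>i. (Suc i, i)) sequentially"

definition nearby :: "(real \<times> real) filter" where
  "nearby = inf (at_top \<times>\<^sub>F at_top) (principal {(s, t). \<bar>s - t\<bar> \<le> 1})"

definition sequence_size :: "(nat \<Rightarrow> enat) \<Rightarrow> nat \<Rightarrow> enat" where
  "sequence_size \<kappa> i = (if i = 0 then 0 else \<kappa> i)"

definition telescope_size :: "(nat \<Rightarrow> enat) \<Rightarrow> real \<Rightarrow> enat" where
  "telescope_size \<kappa> t = (if t < 0 then 0 else if t < 1 then \<infinity> else \<kappa> (nat \<lfloor>t\<rfloor>))"

lemma tendsto_consecutive_iff:
  "((\<lambda>(s, t). f s - f t) \<longlongrightarrow> 0) consecutive \<longleftrightarrow> (\<lambda>i. norm (f (Suc i) - f i)) \<longlonglongrightarrow> 0"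
  by (simp add: consecutive_def filterlim_filtermap tendsto_norm_zero_iff)

lemma eventually_nearby:
  "eventually P nearby \<longleftrightarrow> (\<exists>N. \<forall>s\<ge>N. \<forall>t\<ge>N. \<bar>s - t\<bar> \<le> 1 \<longrightarrow> P (s, t))"
proof
  assume "eventually P nearby"
  then obtain Q where "eventually Q at_top"
    "\<And>s t. Q s \<Longrightarrow> Q t \<Longrightarrow> \<bar>s - t\<bar> \<le> 1 \<Longrightarrow> P (s, t)"
    unfolding nearby_def eventually_inf_principal eventually_prod_same by auto
  then show "\<exists>N. \<forall>s\<ge>N. \<forall>t\<ge>N. \<bar>s - t\<bar> \<le> 1 \<longrightarrow> P (s, t)"
    unfolding eventually_at_top_linorder by meson
next
  assume "\<exists>N. \<forall>s\<ge>N. \<forall>t\<ge>N. \<bar>s - t\<bar> \<le> 1 \<longrightarrow> P (s, t)"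
  then obtain N where "\<And>s t. s \<ge> N \<Longrightarrow> t \<ge> N \<Longrightarrow> \<bar>s - t\<bar> \<le> 1 \<Longrightarrow> P (s, t)"
    by blast
  then show "eventually P nearby"
    unfolding nearby_def eventually_inf_principal eventually_prod_same
    by (intro exI[of _ "\<lambda>t. t \<ge> N"]) (auto simp: eventually_ge_at_top)
qed

lemma tendsto_nearby_iff:
  fixes f :: "real \<Rightarrow> ell2 \<Rightarrow>\<^sub>L ell2"
  shows "((\<lambda>(s, t). f s - f t) \<longlongrightarrow> 0) nearby \<longleftrightarrow>
    (\<forall>e>0. \<exists>N. \<forall>s\<ge>N. \<forall>t\<ge>N. \<bar>s - t\<bar> \<le> 1 \<longrightarrow> norm (f s - f t) < e)"
  unfolding tendsto_iff eventually_nearby by simp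

text \<open>
  Points at distance at most \<open>1\<close> lie in the unit interval that starts at the smaller one, and
  two points of a unit interval are at distance at most \<open>1\<close>.
\<close>

lemma Var_tendsto_iff:
  assumes "bounded (range f)"
  shows "((\<lambda>t. Var t (t + 1) f) \<longlongrightarrow> 0) at_top \<longleftrightarrow> ((\<lambda>(s, t). f s - f t) \<longlongrightarrow> 0) nearby"
proof -
  obtain b where b: "\<And>t. norm (f t) \<le> b"
    using bounded_range_normD[OF assms] by blast
  have upper: "norm (f s - f t) \<le> Var a (a + 1) f" if "s \<in> {a..a + 1}" "t \<in> {a..a + 1}" for a s t
    unfolding Var_def
  proof (rule cSUP_upper2[of _ _ "(t, s)"])
    have "norm (f t - f s) \<le> b + b" for s t
      by (rule order_trans[OF norm_triangle_ineq4 add_mono[OF b b]])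
    then show "bdd_above ((\<lambda>(t1, t2). norm (f t2 - f t1)) ` ({a..a + 1} \<times> {a..a + 1}))"
      by (intro bdd_aboveI2[of _ _ "b + b"]) auto
  qed (use that in auto)
  have least: "Var a (a + 1) f \<le> e"
    if "\<And>s t. s \<in> {a..a + 1} \<Longrightarrow> t \<in> {a..a + 1} \<Longrightarrow> norm (f s - f t) \<le> e" for a e
    unfolding Var_def by (rule cSUP_least) (use that in auto)
  have nonneg: "0 \<le> Var a (a + 1) f" for a
    using upper[of a a a] by simp
  have Var_iff: "((\<lambda>t. Var t (t + 1) f) \<longlongrightarrow> 0) at_top \<longleftrightarrow>
      (\<forall>e>0. \<exists>N. \<forall>a\<ge>N. Var a (a + 1) f < e)"
    unfolding tendsto_iff eventually_at_top_linorder using nonneg by (simp add: dist_real_def)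
  show ?thesis
    unfolding Var_iff tendsto_nearby_iff
  proof (intro iffI allI impI)
    fix e :: real
    assume "\<forall>e>0. \<exists>N. \<forall>a\<ge>N. Var a (a + 1) f < e" and "e > 0"
    then obtain N where N: "\<And>a. a \<ge> N \<Longrightarrow> Var a (a + 1) f < e"
      by blast
    have "norm (f s - f t) < e" if "s \<ge> N" "t \<ge> N" "\<bar>s - t\<bar> \<le> 1" for s t
      using upper[of s "min s t" t] N[of "min s t"] that by force
    then show "\<exists>N. \<forall>s\<ge>N. \<forall>t\<ge>N. \<bar>s - t\<bar> \<le> 1 \<longrightarrow> norm (f s - f t) < e"
      by blast
  next
    fix e :: real
    assume "\<forall>e>0. \<exists>N. \<forall>s\<ge>N. \<forall>t\<ge>N. \<bar>s - t\<bar> \<le> 1 \<longrightarrow> norm (f s - f t) < e" and "e > 0"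
    then obtain N where N: "\<And>s t. s \<ge> N \<Longrightarrow> t \<ge> N \<Longrightarrow> \<bar>s - t\<bar> \<le> 1 \<Longrightarrow> norm (f s - f t) < e / 2"
      using half_gt_zero[OF \<open>e > 0\<close>] by meson
    have "Var a (a + 1) f < e" if "a \<ge> N" for a
    proof -
      have "Var a (a + 1) f \<le> e / 2"
        by (rule least, rule less_imp_le, rule N) (use that in auto)
      then show ?thesis
        using \<open>e > 0\<close> by simp
    qed
    then show "\<exists>N. \<forall>a\<ge>N. Var a (a + 1) f < e"
      by blast
  qed
qed

lemma B_set_eq: "B_set \<kappa> = slow_functions (sequence_size \<kappa>) {} consecutive"
proof -
  have "m 0 = 0 \<and> (\<forall>i\<ge>1. m i \<in> M (\<kappa> i)) \<longleftrightarrow> (\<forall>i. m i \<in> M (sequence_size \<kappa> i))" for m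
    by (auto simp: sequence_size_def M_zero_size Suc_le_eq)
  then show ?thesis
    unfolding B_set_def slow_functions_def tendsto_consecutive_iff by auto
qed

lemma I_set_eq: "I_set \<kappa> = slow_ideal (sequence_size \<kappa>) {} consecutive sequentially"
  by (simp add: I_set_def slow_ideal_def B_set_eq tendsto_norm_zero_iff)

lemma telescope_values_iff:
  "(\<forall>t<0. f t = 0) \<and> (\<forall>t\<ge>0. f t \<in> M \<infinity>) \<and>
      (\<forall>i\<ge>1. \<forall>t\<in>{real i..<real (i + 1)}. f t \<in> M (\<kappa> i)) \<longleftrightarrow>
    (\<forall>t. f t \<in> M (telescope_size \<kappa> t))"
proof (intro iffI conjI allI ballI impI)
  fix t
  assume *: "(\<forall>t<0. f t = 0) \<and> (\<forall>t\<ge>0. f t \<in> M \<infinity>) \<and>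
      (\<forall>i\<ge>1. \<forall>t\<in>{real i..<real (i + 1)}. f t \<in> M (\<kappa> i))"
  have "f t \<in> M (\<kappa> (nat \<lfloor>t\<rfloor>))" if "t \<ge> 1"
  proof -
    have "nat \<lfloor>t\<rfloor> \<ge> 1"
      using that by (simp add: le_nat_iff le_floor_iff)
    moreover have "t \<in> {real (nat \<lfloor>t\<rfloor>)..<real (nat \<lfloor>t\<rfloor> + 1)}"
      using that by simp linarith
    ultimately show ?thesis
      using * by blast
  qed
  then show "f t \<in> M (telescope_size \<kappa> t)"
    using * by (auto simp: telescope_size_def M_zero_size)
next
  assume *: "\<forall>t. f t \<in> M (telescope_size \<kappa> t)"
  show "f t = 0" if "t < 0" for t
    using *[rule_format, of t] that by (simp add: telescope_size_def M_zero_size)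
  show "f t \<in> M \<infinity>" for t
    using *[rule_format, of t] by (rule M_mono) simp
  show "f t \<in> M (\<kappa> i)" if "1 \<le> i" "t \<in> {real i..<real (i + 1)}" for i t
  proof -
    have "\<lfloor>t\<rfloor> = int i"
      using that by (intro floor_unique) auto
    then show ?thesis
      using *[rule_format, of t] that by (simp add: telescope_size_def split: if_splits)
  qed
qed

lemma telescope_set_iff:
  "f \<in> telescope_set \<kappa> \<longleftrightarrow>
    (\<forall>t. f t \<in> M (telescope_size \<kappa> t)) \<and> continuous_on {0..} f \<and> bounded (range f)"
proof -
  have "bounded (f ` {0..}) \<longleftrightarrow> bounded (range f)" if "\<forall>t<0. f t = 0"
  proof
    assume "bounded (f ` {0..})"
    then have "bounded (insert 0 (f ` {0..}))"
      by simp
    moreover have "range f \<subseteq> insert 0 (f ` {0..})"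
      using that by (metis (no_types, lifting) atLeast_iff image_subsetI insert_iff linorder_not_less
          rev_image_eqI)
    ultimately show "bounded (range f)"
      by (rule bounded_subset)
  qed (auto elim: bounded_subset)
  then show ?thesis
    unfolding telescope_values_iff[symmetric] telescope_set_def Cb_set_def by blast
qed

lemma Cvv_set_eq: "Cvv_set \<kappa> = slow_functions (telescope_size \<kappa>) {0..} nearby"
  unfolding Cvv_set_def slow_functions_def telescope_set_iff using Var_tendsto_iff by auto

text \<open>Functions vanishing at infinity vary slowly, so \<open>C0_set\<close> is contained in \<open>Cvv_set\<close>.\<close>

lemma C0_set_eq: "C0_set \<kappa> = slow_ideal (telescope_size \<kappa>) {0..} nearby at_top"
proof -
  have "((\<lambda>(s, t). f s - f t) \<longlongrightarrow> 0) nearby"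
    if f: "(f \<longlongrightarrow> 0) at_top" for f :: "real \<Rightarrow> ell2 \<Rightarrow>\<^sub>L ell2"
    unfolding tendsto_nearby_iff
  proof (intro allI impI)
    fix e :: real
    assume "e > 0"
    then obtain N where N: "\<And>t. t \<ge> N \<Longrightarrow> norm (f t) < e / 2"
      using tendstoD[OF f half_gt_zero[of e]] by (auto simp: eventually_at_top_linorder)
    have "norm (f s - f t) < e" if "s \<ge> N" "t \<ge> N" for s t
      using norm_triangle_ineq4[of "f s" "f t"] N[OF that(1)] N[OF that(2)] by linarith
    then show "\<exists>N. \<forall>s\<ge>N. \<forall>t\<ge>N. \<bar>s - t\<bar> \<le> 1 \<longrightarrow> norm (f s - f t) < e"
      by blast
  qed
  then show ?thesis
    by (auto simp: C0_set_def slow_ideal_def slow_functions_def telescope_set_iff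
        tendsto_norm_zero_iff)
qed

section \<open>Restriction and interpolation\<close>

text \<open>
  The value at \<open>t \<in> [i, i + 1)\<close> lies between \<open>m (i - 1)\<close> and \<open>m i\<close>, and not between \<open>m i\<close> and
  \<open>m (i + 1)\<close>: it has to be supported on the first \<open>\<kappa> i\<close> coordinates, and \<open>\<kappa> (i + 1)\<close> may be larger.
  With \<open>m 0 = 0\<close> the interpolation vanishes for \<open>t \<le> 1\<close>, including negative \<open>t\<close>, where
  \<open>nat \<lfloor>t\<rfloor> = 0\<close>.
\<close>

definition interpolate :: "(nat \<Rightarrow> ell2 \<Rightarrow>\<^sub>L ell2) \<Rightarrow> real \<Rightarrow> ell2 \<Rightarrow>\<^sub>L ell2" where
  "interpolate m t = (1 - frac t) *\<^sub>R m (nat \<lfloor>t\<rfloor> - 1) + frac t *\<^sub>R m (nat \<lfloor>t\<rfloor>)"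

lemma interpolate_in_M:
  assumes adm: "admissible \<kappa>" and m: "\<And>i. m i \<in> M (sequence_size \<kappa> i)"
  shows "interpolate m t \<in> M (telescope_size \<kappa> t)"
proof (cases "t < 1")
  case True
  then have "nat \<lfloor>t\<rfloor> = 0"
    by (simp add: floor_le_iff)
  moreover have "m 0 = 0"
    using m[of 0] by (simp add: sequence_size_def M_zero_size)
  ultimately show ?thesis
    by (simp add: interpolate_def zero_in_M)
next
  case False
  define i where "i = nat \<lfloor>t\<rfloor>"
  have i: "i \<ge> 1"
    using False by (simp add: i_def le_nat_iff le_floor_iff)
  have "sequence_size \<kappa> (i - 1) \<le> \<kappa> i"
    using mono_onD[of "{1..}" \<kappa> "i - 1" i] adm i by (simp add: admissible_def sequence_size_def)
  then have "m (i - 1) \<in> M (\<kappa> i)"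
    using M_mono[OF m] by blast
  moreover have "m i \<in> M (\<kappa> i)"
    using m[of i] i by (simp add: sequence_size_def)
  ultimately show ?thesis
    using False unfolding interpolate_def i_def[symmetric]
    by (simp add: telescope_size_def i_def[symmetric] M_add M_scaleR)
qed

lemma norm_interpolate_le:
  assumes "\<And>i. norm (m i) \<le> b"
  shows "norm (interpolate m t) \<le> b"
proof -
  have "norm (interpolate m t) \<le> (1 - frac t) * b + frac t * b"
    unfolding interpolate_def using assms frac_ge_0[of t] less_imp_le[OF frac_lt_1[of t]]
    by (intro norm_triangle_le add_mono) (auto intro!: mult_left_mono)
  then show ?thesis
    by (simp add: algebra_simps)
qed

lemma norm_interpolate_diff_le:
  "norm (interpolate m t - m (nat \<lfloor>t\<rfloor>)) \<le> norm (m (nat \<lfloor>t\<rfloor>) - m (nat \<lfloor>t\<rfloor> - 1))"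
proof -
  have "interpolate m t - m (nat \<lfloor>t\<rfloor>) = - ((1 - frac t) *\<^sub>R (m (nat \<lfloor>t\<rfloor>) - m (nat \<lfloor>t\<rfloor> - 1)))"
    by (simp add: interpolate_def algebra_simps)
  then have "norm (interpolate m t - m (nat \<lfloor>t\<rfloor>))
      = (1 - frac t) * norm (m (nat \<lfloor>t\<rfloor>) - m (nat \<lfloor>t\<rfloor> - 1))"
    using frac_lt_1[of t] by simp
  also have "\<dots> \<le> norm (m (nat \<lfloor>t\<rfloor>) - m (nat \<lfloor>t\<rfloor> - 1))"
    using frac_ge_0[of t] by (intro mult_left_le_one_le) (auto simp: less_imp_le[OF frac_lt_1])
  finally show ?thesis .
qed

text \<open>
  On each closed interval \<open>[n, n + 1]\<close> the interpolation is affine, also at the right end point,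
  where both formulas give \<open>m n\<close>.
\<close>

lemma continuous_on_interpolate: "continuous_on {0..} (interpolate m)"
proof -
  have piece: "continuous_on {real n..real (Suc n)} (interpolate m)" for n
  proof -
    have "interpolate m t = (1 - (t - real n)) *\<^sub>R m (n - 1) + (t - real n) *\<^sub>R m n"
      if t: "t \<in> {real n..real (Suc n)}" for t
    proof (cases "t = real (Suc n)")
      case True
      have floor: "\<lfloor>t\<rfloor> = int (Suc n)"
        unfolding True by (rule floor_of_nat)
      have frac: "frac t = 0"
        unfolding frac_def floor True by simp
      then show ?thesis
        unfolding interpolate_def floor nat_int frac by (simp add: True)
    next
      case False
      then have "\<lfloor>t\<rfloor> = int n"
        using t by (intro floor_unique) auto
      then show ?thesis
        by (simp add: interpolate_def frac_def)
    qed
    then show ?thesis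
      by (subst continuous_on_cong[OF refl]) (auto intro!: continuous_intros)
  qed
  have initial: "continuous_on {0..real n} (interpolate m)" for n
  proof (induction n)
    case (Suc n)
    have "{0..real (Suc n)} = {0..real n} \<union> {real n..real (Suc n)}"
      by auto
    then show ?case
      using continuous_on_closed_Un[OF _ _ Suc piece[of n]] by simp
  qed simp
  show ?thesis
    unfolding continuous_on_eq_continuous_within
  proof
    fix x :: real
    assume "x \<in> {0..}"
    moreover obtain n where n: "x < real n"
      using reals_Archimedean2 by blast
    ultimately have "continuous (at x within {0..real n}) (interpolate m)"
      using initial[of n] by (simp add: continuous_on_eq_continuous_within)
    moreover have "at x within {0..} = at x within {0..real n}"
      using n by (intro at_within_nhd[of _ "{..<real n}"]) auto
    ultimately show "continuous (at x within {0..}) (interpolate m)"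
      by simp
  qed
qed

text \<open>
  For large \<open>t\<close> the interpolation follows \<open>m (nat \<lfloor>t\<rfloor>)\<close>, and integer parts of arguments at distance at
  most \<open>1\<close> are equal or consecutive.
\<close>

lemma interpolate_slow:
  assumes m: "((\<lambda>(i, j). m i - m j) \<longlongrightarrow> 0) consecutive"
  shows "((\<lambda>(s, t). interpolate m s - interpolate m t) \<longlongrightarrow> 0) nearby"
  unfolding tendsto_nearby_iff
proof (intro allI impI)
  fix e :: real
  assume e: "e > 0"
  have "(\<lambda>i. norm (m (Suc i) - m i)) \<longlonglongrightarrow> 0"
    using m unfolding tendsto_consecutive_iff .
  moreover have "e / 3 > 0"
    using e by simp
  ultimately have "eventually (\<lambda>i. norm (m (Suc i) - m i) < e / 3) sequentially"
    by (rule order_tendstoD)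
  then obtain N where N: "\<And>i. i \<ge> N \<Longrightarrow> norm (m (Suc i) - m i) < e / 3"
    by (auto simp: eventually_sequentially)
  have floor_gt: "nat \<lfloor>t\<rfloor> \<ge> Suc N" if "t \<ge> real (Suc N)" for t
    using that by (simp add: le_nat_iff le_floor_iff)
  have close: "norm (interpolate m t - m (nat \<lfloor>t\<rfloor>)) < e / 3" if t: "t \<ge> real (Suc N)" for t
  proof -
    obtain j where "nat \<lfloor>t\<rfloor> = Suc j" "j \<ge> N"
      using floor_gt[OF t] by (cases "nat \<lfloor>t\<rfloor>") auto
    then show ?thesis
      using norm_interpolate_diff_le[of m t] N[of j] by simp
  qed
  have ordered: "norm (interpolate m s - interpolate m t) < e"
    if st: "s \<ge> real (Suc N)" "s \<le> t" "t \<le> s + 1" for s t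
  proof -
    have "\<lfloor>s\<rfloor> \<le> \<lfloor>t\<rfloor>" "\<lfloor>t\<rfloor> \<le> \<lfloor>s\<rfloor> + 1"
      using st floor_mono[of s t] floor_mono[of t "s + 1"] by simp_all
    moreover have "\<lfloor>s\<rfloor> \<ge> 0"
      using st by (simp add: le_floor_iff)
    ultimately have "nat \<lfloor>t\<rfloor> = nat \<lfloor>s\<rfloor> \<or> nat \<lfloor>t\<rfloor> = Suc (nat \<lfloor>s\<rfloor>)"
      by linarith
    then have "norm (m (nat \<lfloor>t\<rfloor>) - m (nat \<lfloor>s\<rfloor>)) < e / 3"
      using N[of "nat \<lfloor>s\<rfloor>"] floor_gt[OF st(1)] e by auto
    moreover have "norm (interpolate m s - interpolate m t)
        \<le> norm (interpolate m s - m (nat \<lfloor>s\<rfloor>)) + norm (m (nat \<lfloor>t\<rfloor>) - m (nat \<lfloor>s\<rfloor>))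
          + norm (interpolate m t - m (nat \<lfloor>t\<rfloor>))"
      using norm_triangle_ineq4[of "(interpolate m s - m (nat \<lfloor>s\<rfloor>)) - (m (nat \<lfloor>t\<rfloor>) - m (nat \<lfloor>s\<rfloor>))"
          "interpolate m t - m (nat \<lfloor>t\<rfloor>)"]
        norm_triangle_ineq4[of "interpolate m s - m (nat \<lfloor>s\<rfloor>)" "m (nat \<lfloor>t\<rfloor>) - m (nat \<lfloor>s\<rfloor>)"]
      by simp
    ultimately show ?thesis
      using close[of s] close[of t] st by linarith
  qed
  have "norm (interpolate m s - interpolate m t) < e"
    if "s \<ge> real (Suc N)" "t \<ge> real (Suc N)" "\<bar>s - t\<bar> \<le> 1" for s t
    using ordered[of s t] ordered[of t s] that by (cases "s \<le> t") (auto simp: norm_minus_commute)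
  then show "\<exists>N. \<forall>s\<ge>N. \<forall>t\<ge>N. \<bar>s - t\<bar> \<le> 1 \<longrightarrow>
      norm (interpolate m s - interpolate m t) < e"
    by blast
qed

lemma interpolate_slow_functions:
  assumes "admissible \<kappa>" and m: "m \<in> slow_functions (sequence_size \<kappa>) {} consecutive"
  shows "interpolate m \<in> slow_functions (telescope_size \<kappa>) {0..} nearby"
proof -
  obtain b where "\<And>i. norm (m i) \<le> b"
    using slow_functions_bounded[OF m] by blast
  then have "bounded (range (interpolate m))"
    by (intro bounded_range_normI norm_interpolate_le)
  then show ?thesis
    using assms continuous_on_interpolate interpolate_slow interpolate_in_M
    by (simp add: slow_functions_def)
qed

text \<open>The index \<open>0\<close> is sent to a point where functions on the half-line take the value \<open>0\<close>.\<close>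

definition sample_point :: "nat \<Rightarrow> real" where
  "sample_point i = (if i = 0 then - 1 else real i)"

lemma filterlim_sample_point: "filterlim sample_point at_top sequentially"
  by (rule filterlim_mono_eventually[OF filterlim_real_sequentially order_refl order_refl])
    (auto simp: sample_point_def eventually_sequentially intro: exI[of _ 1])

lemma filterlim_sample_point_nearby:
  "filterlim (\<lambda>i. (sample_point (Suc i), sample_point i)) nearby sequentially"
  unfolding nearby_def filterlim_inf filterlim_principal
proof
  show "filterlim (\<lambda>i. (sample_point (Suc i), sample_point i)) (at_top \<times>\<^sub>F at_top) sequentially"
    using filterlim_compose[OF filterlim_sample_point filterlim_Suc] filterlim_sample_point
    by (rule filterlim_Pair)
  show "\<forall>\<^sub>F i in sequentially. (sample_point (Suc i), sample_point i) \<in> {(s, t). \<bar>s - t\<bar> \<le> 1}"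
    by (auto simp: sample_point_def eventually_sequentially intro!: exI[of _ 1])
qed

lemma sample_slow_functions:
  assumes f: "f \<in> slow_functions (telescope_size \<kappa>) {0..} nearby"
  shows "(\<lambda>i. f (sample_point i)) \<in> slow_functions (sequence_size \<kappa>) {} consecutive"
proof -
  have "f (sample_point i) \<in> M (sequence_size \<kappa> i)" for i
  proof -
    have "telescope_size \<kappa> (sample_point i) = sequence_size \<kappa> i"
      by (simp add: telescope_size_def sample_point_def sequence_size_def)
    then show ?thesis
      using f by (auto simp: slow_functions_def dest: spec[of _ "sample_point i"])
  qed
  moreover have "bounded (range (\<lambda>i. f (sample_point i)))"
    using f by (auto simp: slow_functions_def elim!: bounded_subset)
  moreover have "((\<lambda>(i, j). f (sample_point i) - f (sample_point j)) \<longlongrightarrow> 0) consecutive"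
  proof -
    have "((\<lambda>(s, t). f s - f t) \<longlongrightarrow> 0) nearby"
      using f by (simp add: slow_functions_def)
    from filterlim_compose[OF this filterlim_sample_point_nearby] show ?thesis
      by (simp add: consecutive_def filterlim_filtermap)
  qed
  ultimately show ?thesis
    by (simp add: slow_functions_def)
qed

text \<open>
  A slowly varying function that tends to \<open>0\<close> along the integers tends to \<open>0\<close>, because every
  argument is at distance at most \<open>1\<close> from its integer part.
\<close>

lemma sample_tendsto_zero_iff:
  assumes f: "((\<lambda>(s, t). f s - f t) \<longlongrightarrow> (0 :: ell2 \<Rightarrow>\<^sub>L ell2)) nearby"
  shows "(\<lambda>i. f (sample_point i)) \<longlonglongrightarrow> 0 \<longleftrightarrow> (f \<longlongrightarrow> 0) at_top"
proof
  assume "(f \<longlongrightarrow> 0) at_top"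
  then show "(\<lambda>i. f (sample_point i)) \<longlonglongrightarrow> 0"
    by (rule filterlim_compose[OF _ filterlim_sample_point])
next
  assume sample: "(\<lambda>i. f (sample_point i)) \<longlonglongrightarrow> 0"
  have nat_floor: "filterlim (\<lambda>t :: real. nat \<lfloor>t\<rfloor>) sequentially at_top"
    by (rule filterlim_compose[OF filterlim_nat_sequentially filterlim_floor_sequentially])
  have limit: "((\<lambda>t :: real. f (sample_point (nat \<lfloor>t\<rfloor>))) \<longlongrightarrow> 0) at_top"
    using filterlim_compose[OF sample nat_floor] .
  have "filterlim (\<lambda>t. (t, sample_point (nat \<lfloor>t\<rfloor>))) nearby at_top"
    unfolding nearby_def filterlim_inf filterlim_principal
  proof
    have "filterlim (\<lambda>t :: real. sample_point (nat \<lfloor>t\<rfloor>)) at_top at_top"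
      using filterlim_compose[OF filterlim_sample_point nat_floor] .
    with filterlim_ident show "filterlim (\<lambda>t :: real. (t, sample_point (nat \<lfloor>t\<rfloor>))) (at_top \<times>\<^sub>F at_top) at_top"
      by (rule filterlim_Pair)
    have "\<bar>t - sample_point (nat \<lfloor>t\<rfloor>)\<bar> \<le> 1" if "t \<ge> 1" for t
    proof -
      have "nat \<lfloor>t\<rfloor> \<noteq> 0" "real (nat \<lfloor>t\<rfloor>) = of_int \<lfloor>t\<rfloor>"
        using that by (auto simp: not_le le_floor_iff)
      then show ?thesis
        using that by (simp add: sample_point_def) linarith
    qed
    then show "\<forall>\<^sub>F t in at_top. (t, sample_point (nat \<lfloor>t\<rfloor>)) \<in> {(s, t). \<bar>s - t\<bar> \<le> 1}"
      by (auto simp: eventually_at_top_linorder)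
  qed
  from filterlim_compose[OF f this]
  have "((\<lambda>t. f t - f (sample_point (nat \<lfloor>t\<rfloor>))) \<longlongrightarrow> 0) at_top"
    by simp
  from tendsto_add[OF this limit] show "(f \<longlongrightarrow> 0) at_top"
    by simp
qed

lemma interpolate_sample_point:
  assumes "m 0 = 0"
  shows "interpolate m (sample_point i) = m (i - 1)"
  using assms by (simp add: interpolate_def sample_point_def frac_def)

text \<open>
  Sampling the interpolation shifts the sequence by one index, which slow variation makes
  negligible modulo null sequences.
\<close>

lemma interpolate_section:
  assumes adm: "admissible \<kappa>" and m: "m \<in> slow_functions (sequence_size \<kappa>) {} consecutive"
  shows "(\<lambda>i. interpolate m (sample_point i) - m i)
    \<in> slow_ideal (sequence_size \<kappa>) {} consecutive sequentially"
proof -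
  let ?S = "slow_functions (sequence_size \<kappa>) {} consecutive"
  have "m 0 \<in> M (sequence_size \<kappa> 0)"
    using m by (simp add: slow_functions_def)
  then have "m 0 = 0"
    by (simp add: sequence_size_def M_zero_size)
  note [simp] = interpolate_sample_point[of m, OF this]
  have "(\<lambda>i. m (i - 1) - m i) \<in> ?S"
    using slow_functions_add[OF sample_slow_functions[OF interpolate_slow_functions[OF adm m]]
        slow_functions_scale[OF m, of "complex_of_real (- 1)"]]
    unfolding op_scaleC_of_real by simp
  moreover have "(\<lambda>i. m (i - 1) - m i) \<longlonglongrightarrow> 0"
  proof -
    have "(\<lambda>i. norm (m (Suc i) - m i)) \<longlonglongrightarrow> 0"
      using m by (simp only: slow_functions_def mem_Collect_eq tendsto_consecutive_iff)
    then have "(\<lambda>i. norm (m (Suc i - 1) - m (Suc i))) \<longlonglongrightarrow> 0"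
      by (simp add: norm_minus_commute)
    then have "(\<lambda>i. m (Suc i - 1) - m (Suc i)) \<longlonglongrightarrow> 0"
      by (rule tendsto_norm_zero_cancel)
    then show ?thesis
      by (rule LIMSEQ_imp_Suc)
  qed
  ultimately show ?thesis
    by (simp add: slow_ideal_def)
qed

theorem lemma4p3:
  fixes \<kappa> :: "nat \<Rightarrow> enat"
  assumes "admissible \<kappa>"
  shows "Q \<kappa> \<cong>\<^sup>* quotient_algebra (pointwise_algebra (Cvv_set \<kappa>)) (C0_set \<kappa>)"
  unfolding Q_def B_set_eq I_set_eq Cvv_set_eq C0_set_eq
proof (rule quotient_star_isomorphic_of_reindexing[where h = sample_point and E = interpolate])
  let ?S = "slow_functions (sequence_size \<kappa>) {} consecutive"
  let ?T = "slow_functions (telescope_size \<kappa>) {0..} nearby"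
  show "(\<lambda>i. f (sample_point i)) \<in> ?S" if "f \<in> ?T" for f
    using that by (rule sample_slow_functions)
  show "slow_ideal (telescope_size \<kappa>) {0..} nearby at_top =
      {f \<in> ?T. (\<lambda>i. f (sample_point i)) \<in> slow_ideal (sequence_size \<kappa>) {} consecutive sequentially}"
  proof -
    have "(f \<longlongrightarrow> 0) at_top \<longleftrightarrow>
        (\<lambda>i. f (sample_point i)) \<in> slow_ideal (sequence_size \<kappa>) {} consecutive sequentially"
      if f: "f \<in> ?T" for f
    proof -
      have "((\<lambda>(s, t). f s - f t) \<longlongrightarrow> 0) nearby"
        using f by (simp add: slow_functions_def)
      from sample_tendsto_zero_iff[OF this] show ?thesis
        using sample_slow_functions[OF f] by (simp add: slow_ideal_def)
    qed
    then show ?thesis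
      by (auto simp: slow_ideal_def[of "telescope_size \<kappa>"])
  qed
  show "interpolate m \<in> ?T" if "m \<in> ?S" for m
    using assms that by (rule interpolate_slow_functions)
  show "(\<lambda>i. interpolate m (sample_point i) - m i)
      \<in> slow_ideal (sequence_size \<kappa>) {} consecutive sequentially" if "m \<in> ?S" for m
    using assms that by (rule interpolate_section)
  show "norm (interpolate m t) \<le> (SUP i. norm (m i))" if "m \<in> ?S" for m t
    by (rule norm_interpolate_le, rule pointwise_ideal.norm_le_SUP[OF pointwise_ideal_slow that])
qed (rule pointwise_ideal_slow)+

end
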